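(* Let $\mathcal{H}$ be a Hilbert space with orthonormal basis $\{e_n\}_{n\ge0}$, and let $\Lambda:\mathcal{H}\to\mathcal{B}(\mathcal{H})$ satisfy the canonical anticommutation relations: for all $u,v\in\mathcal{H}$, $\Lambda(u)\Lambda(v)+\Lambda(v)\Lambda(u)=0$ and $\Lambda(u)\Lambda(v)^*+\Lambda(v)^*\Lambda(u)=(u,v)I$. Put $C_n=\Lambda(e_n)$. For $\alpha=(\alpha_0,\alpha_1,\ldots)\in\ell^2$ let $\Gamma_\alpha=[\alpha_{i+j}C_{i+j}]_{i,j\ge0}$, regarded as a bounded operator on $\ell^2(\mathcal{H})$, let $S\in\mathcal{B}(\ell^2(\mathcal{H}))$ be the unilateral forward shift $S(x_0,x_1,\ldots)=(0,x_0,x_1,\ldots)$, and let $$R(\Gamma_\alpha)=\begin{bmatrix}S^* & \Gamma_\alpha\\ 0 & S\end{bmatrix},\qquad R(0)=S^*\oplus S\qquad\text{in }\mathcal{B}(\ell^2(\mathcal{H})\oplus\ell^2(\mathcal{H})).$$ Then $R(\Gamma_\alpha)$ is similar to a contraction if and only if there is a constant $s$ such that for every $N\in\mathbb{N}$ and all $x_0,\ldots,x_N\in\{0\}\oplus(\mathcal{H}\oplus\{0\}\oplus\{0\}\oplus\cdots)$, $$\Big\|\sum_{n=0}^{N}\big(R(\Gamma_\alpha)^n-R(0)^n\big)x_n\Big\|\le s\Big(\sum_{n=0}^N\|x_n\|^2\Big)^{1/2}$$ (i.e. $R(\Gamma_\alpha)$ is quadratically near $S^*\oplus S$ modulo $\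mathcal{H}$).
   Context: An operator is similar to a contraction if it is conjugate by an invertible operator to an operator of norm at most 1. *)

theory Defs
  imports "HOL-Analysis.Analysis"
begin

class complex_vector = real_vector +
  fixes scaleC :: "complex \<Rightarrow> 'a \<Rightarrow> 'a" (infixr "*\<^sub>C" 75)
  assumes scaleC_add_right: "a *\<^sub>C (x + y) = a *\<^sub>C x + a *\<^sub>C y"
    and scaleC_add_left: "(a + b) *\<^sub>C x = a *\<^sub>C x + b *\<^sub>C x"
    and scaleC_scaleC: "a *\<^sub>C (b *\<^sub>C x) = (a * b) *\<^sub>C x"
    and scaleC_one: "1 *\<^sub>C x = x"
    and scaleR_scaleC: "scaleR r x = complex_of_real r *\<^sub>C x"

class complex_inner = complex_vector + real_normed_vector +
  fixes cinner :: "'a \<Rightarrow> 'a \<Rightarrow> complex"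
  assumes cinner_commute: "cinner x y = cnj (cinner y x)"
    and cinner_add_left: "cinner (x + y) z = cinner x z + cinner y z"
    and cinner_scaleC_left: "cinner (a *\<^sub>C x) y = a * cinner x y"
    and cinner_real_nonneg: "Im (cinner x x) = 0 \<and> 0 \<le> Re (cinner x x)"
    and cinner_eq_zero_iff: "cinner x x = 0 \<longleftrightarrow> x = 0"
    and norm_eq_sqrt_cinner: "norm x = sqrt (Re (cinner x x))"

(* A Hilbert space is a complete complex inner product space: we use the
sort complex_inner + complete_space. *)

definition orthonormal_basis :: "(nat \<Rightarrow> 'a::complex_inner) \<Rightarrow> bool" where
  "orthonormal_basis e \<longleftrightarrow>
     (\<forall>m n. cinner (e m) (e n) = (if m = n then 1 else 0)) \<and>
     (\<forall>x. (\<forall>n. cinner x (e n) = 0) \<longrightarrow> x = 0)"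

definition bounded_clinear_op :: "('a::complex_inner \<Rightarrow> 'a) \<Rightarrow> bool" where
  "bounded_clinear_op A \<longleftrightarrow>
     (\<forall>x y. A (x + y) = A x + A y) \<and> (\<forall>c x. A (c *\<^sub>C x) = c *\<^sub>C A x) \<and>
     (\<exists>K. \<forall>x. norm (A x) \<le> K * norm x)"

definition cadjoint :: "('a::complex_inner \<Rightarrow> 'a) \<Rightarrow> ('a \<Rightarrow> 'a)" where
  "cadjoint A = (SOME B. \<forall>x y. cinner (A x) y = cinner x (B y))"

definition CAR :: "('a::complex_inner \<Rightarrow> 'a \<Rightarrow> 'a) \<Rightarrow> bool" where
  "CAR \<Lambda> \<longleftrightarrow> (\<forall>u. bounded_clinear_op (\<Lambda> u)) \<and>
     (\<forall>u v x. \<Lambda> u (\<Lambda> v x) + \<Lambda> v (\<Lambda> u x) = 0) \<and>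
     (\<forall>u v x. \<Lambda> u (cadjoint (\<Lambda> v) x) + cadjoint (\<Lambda> v) (\<Lambda> u x) = cinner u v *\<^sub>C x)"

definition l2 :: "(nat \<Rightarrow> 'a::complex_inner) set" where
  "l2 = {x. summable (\<lambda>n. (norm (x n))\<^sup>2)}"

definition l2norm :: "(nat \<Rightarrow> 'a::complex_inner) \<Rightarrow> real" where
  "l2norm x = sqrt (\<Sum>n. (norm (x n))\<^sup>2)"

type_synonym 'a l2sum = "(nat \<Rightarrow> 'a) \<times> (nat \<Rightarrow> 'a)"

definition K2 :: "'a::complex_inner l2sum set" where
  "K2 = l2 \<times> l2"

definition Knorm :: "'a::complex_inner l2sum \<Rightarrow> real" where
  "Knorm z = sqrt ((l2norm (fst z))\<^sup>2 + (l2norm (snd z))\<^sup>2)"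

definition Kadd :: "'a::complex_inner l2sum \<Rightarrow> 'a l2sum \<Rightarrow> 'a l2sum" where
  "Kadd z w = ((\<lambda>k. fst z k + fst w k), (\<lambda>k. snd z k + snd w k))"

definition Kdiff :: "'a::complex_inner l2sum \<Rightarrow> 'a l2sum \<Rightarrow> 'a l2sum" where
  "Kdiff z w = ((\<lambda>k. fst z k - fst w k), (\<lambda>k. snd z k - snd w k))"

definition Kscale :: "complex \<Rightarrow> 'a::complex_inner l2sum \<Rightarrow> 'a l2sum" where
  "Kscale c z = ((\<lambda>k. c *\<^sub>C fst z k), (\<lambda>k. c *\<^sub>C snd z k))"

definition Ksum :: "(nat \<Rightarrow> 'a::complex_inner l2sum) \<Rightarrow> nat set \<Rightarrow> 'a l2sum" where
  "Ksum f A = ((\<lambda>k. \<Sum>n\<in>A. fst (f n) k), (\<lambda>k. \<Sum>n\<in>A. snd (f n) k))"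

(* Bounded linear operators on \<ell>^2(H) \<oplus> \<ell>^2(H) (only their values on the
space K2 matter). *)
definition bounded_K_op :: "('a::complex_inner l2sum \<Rightarrow> 'a l2sum) \<Rightarrow> bool" where
  "bounded_K_op T \<longleftrightarrow> T ` K2 \<subseteq> K2 \<and>
     (\<forall>z\<in>K2. \<forall>w\<in>K2. T (Kadd z w) = Kadd (T z) (T w)) \<and>
     (\<forall>c. \<forall>z\<in>K2. T (Kscale c z) = Kscale c (T z)) \<and>
     (\<exists>M. \<forall>z\<in>K2. Knorm (T z) \<le> M * Knorm z)"

definition invertible_K_op :: "('a::complex_inner l2sum \<Rightarrow> 'a l2sum) \<Rightarrow> bool" where
  "invertible_K_op T \<longleftrightarrow> bounded_K_op T \<and> bij_betw T K2 K2 \<and>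
     bounded_K_op (inv_into K2 T)"

definition similar_to_contraction :: "('a::complex_inner l2sum \<Rightarrow> 'a l2sum) \<Rightarrow> bool" where
  "similar_to_contraction R \<longleftrightarrow>
     (\<exists>T. invertible_K_op T \<and> (\<forall>z\<in>K2. Knorm (inv_into K2 T (R (T z))) \<le> Knorm z))"

definition fshift :: "(nat \<Rightarrow> 'a::complex_inner) \<Rightarrow> (nat \<Rightarrow> 'a)" where
  "fshift x = (\<lambda>n. if n = 0 then 0 else x (n - 1))"

definition bshift :: "(nat \<Rightarrow> 'a::complex_inner) \<Rightarrow> (nat \<Rightarrow> 'a)" where
  "bshift x = (\<lambda>n. x (Suc n))"

definition Hankel_op :: "(nat \<Rightarrow> complex) \<Rightarrow> (nat \<Rightarrow> 'a::complex_inner \<Rightarrow> 'a)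
    \<Rightarrow> (nat \<Rightarrow> 'a) \<Rightarrow> (nat \<Rightarrow> 'a)" where
  "Hankel_op \<alpha> C x = (\<lambda>i. \<Sum>j. \<alpha> (i + j) *\<^sub>C C (i + j) (x j))"

definition Rop :: "((nat \<Rightarrow> 'a::complex_inner) \<Rightarrow> (nat \<Rightarrow> 'a)) \<Rightarrow> 'a l2sum \<Rightarrow> 'a l2sum" where
  "Rop \<Gamma> z = ((\<lambda>k. bshift (fst z) k + \<Gamma> (snd z) k), fshift (snd z))"

definition R0 :: "'a::complex_inner l2sum \<Rightarrow> 'a l2sum" where
  "R0 z = (bshift (fst z), fshift (snd z))"

definition Hsub :: "'a::complex_inner l2sum set" where
  "Hsub = {((\<lambda>k. 0), (\<lambda>k. if k = 0 then h else 0)) | h. True}"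

definition quad_near_mod_H :: "('a::complex_inner l2sum \<Rightarrow> 'a l2sum) \<Rightarrow> ('a l2sum \<Rightarrow> 'a l2sum) \<Rightarrow> bool" where
  "quad_near_mod_H R R' \<longleftrightarrow> (\<exists>s. \<forall>N. \<forall>x :: nat \<Rightarrow> 'a l2sum. (\<forall>n\<le>N. x n \<in> Hsub) \<longrightarrow>
      Knorm (Ksum (\<lambda>n. Kdiff ((R ^^ n) (x n)) ((R' ^^ n) (x n))) {..N})
        \<le> s * sqrt (\<Sum>n\<le>N. (Knorm (x n))\<^sup>2))"

end

theory Submission
  imports Defs "HOL-Library.Discrete_Functions"
begin

text \<open>
  Since \<open>\<Gamma> S = S\<^sup>* \<Gamma>\<close>, the corner of \<open>R(\<Gamma>)\<^sup>n\<close> is \<open>n S\<^sup>*\<^sup>n\<^sup>-\<^sup>1 \<Gamma>\<close>, so quadratic nearness says that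
  the matrix with entries \<open>(j + 1) \<alpha>\<^sub>i\<^sub>+\<^sub>j C\<^sub>i\<^sub>+\<^sub>j\<close> is bounded. Shifted by one column, this matrix is
  a solution \<open>X\<close> of \<open>X S - S\<^sup>* X = \<Gamma>\<close>, and then the shear by \<open>X\<close> conjugates \<open>R(\<Gamma>)\<close> to the
  contraction \<open>R(0)\<close>.

  For the converse, both halves rest on \<open>T T\<^sup>* + T\<^sup>* T = \<parallel>c\<parallel>\<^sup>2 I\<close> for \<open>T = \<Sum> c\<^sub>k C\<^sub>k\<close>, in the form of an
  identity for convolutions. Applied to a matrix model \<open>B\<^sub>k\<close> of the anticommutation relations
  and to the orbits of a contraction \<open>P\<close> it gives \<open>\<parallel>\<Sum> c\<^sub>k B\<^sub>k \<otimes> P\<^sup>k\<parallel> \<le> \<parallel>c\<parallel>\<close>; testing the conjugated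
  \<open>R(\<Gamma>)\<close> on a maximally entangled Fock vector yields \<open>\<Sum> (k + 1)\<^sup>2 |\<alpha>\<^sub>k|\<^sup>2 < \<infinity>\<close>. Applied to the \<open>C\<^sub>k\<close>
  themselves it bounds the Hankel matrix of any square-summable sequence by its norm, and a
  dyadic decomposition of the columns then bounds the weighted matrix.
\<close>

section \<open>Elementary calculus of complex inner product spaces\<close>

lemma cinner_add_right: "cinner x (y + z) = cinner x y + cinner (x::'a::complex_inner) z"
  by (metis cinner_add_left cinner_commute complex_cnj_add)

lemma cinner_scaleC_right: "cinner x (a *\<^sub>C y) = cnj a * cinner (x::'a::complex_inner) y"
  by (metis cinner_scaleC_left cinner_commute complex_cnj_mult)

lemma cinner_zero_left [simp]: "cinner 0 (y::'a::complex_inner) = 0"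
  using cinner_add_left[of 0 0 y] by simp

lemma cinner_zero_right [simp]: "cinner (y::'a::complex_inner) 0 = 0"
  using cinner_add_right[of y 0 0] by simp

lemma cinner_minus_left: "cinner (- x) y = - cinner (x::'a::complex_inner) y"
  using cinner_add_left[of x "- x" y] by (simp add: eq_neg_iff_add_eq_0 add.commute)

lemma cinner_diff_left: "cinner (x - y) z = cinner x z - cinner (y::'a::complex_inner) z"
  using cinner_add_left[of x "- y" z] by (simp add: cinner_minus_left)

lemma cinner_sum_left: "cinner (\<Sum>i\<in>A. f i) (y::'a::complex_inner) = (\<Sum>i\<in>A. cinner (f i) y)"
  by (induction A rule: infinite_finite_induct) (auto simp: cinner_add_left)

lemma cinner_sum_right: "cinner (y::'a::complex_inner) (\<Sum>i\<in>A. f i) = (\<Sum>i\<in>A. cinner y (f i))"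
  by (induction A rule: infinite_finite_induct) (auto simp: cinner_add_right)

lemma cinner_self: "cinner x x = complex_of_real ((norm (x::'a::complex_inner))\<^sup>2)"
  using cinner_real_nonneg[of x] by (simp add: complex_eq_iff norm_eq_sqrt_cinner)

lemma scaleC_zero_right [simp]: "c *\<^sub>C (0::'a::complex_vector) = 0"
  using scaleC_add_right[of c 0 "0::'a"] by simp

lemma scaleC_zero_left [simp]: "0 *\<^sub>C (x::'a::complex_vector) = 0"
  using scaleC_add_left[of 0 0 x] by simp

lemma scaleC_minus1: "(-1) *\<^sub>C x = - (x::'a::complex_vector)"
  using scaleC_add_left[of 1 "-1" x] by (simp add: scaleC_one eq_neg_iff_add_eq_0 add.commute)

lemma scaleC_sum_left: "(\<Sum>i\<in>A. f i) *\<^sub>C (x::'a::complex_vector) = (\<Sum>i\<in>A. f i *\<^sub>C x)"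
  by (induction A rule: infinite_finite_induct) (auto simp: scaleC_add_left)

lemma norm_scaleC: "norm (c *\<^sub>C x) = cmod c * norm (x::'a::complex_inner)"
proof -
  have "complex_of_real ((norm (c *\<^sub>C x))\<^sup>2) = c * cnj c * complex_of_real ((norm x)\<^sup>2)"
    by (simp only: cinner_self[symmetric] cinner_scaleC_left cinner_scaleC_right mult_ac)
  also have "\<dots> = complex_of_real ((cmod c * norm x)\<^sup>2)"
    by (simp add: complex_norm_square[symmetric] power_mult_distrib)
  finally have "(norm (c *\<^sub>C x))\<^sup>2 = (cmod c * norm x)\<^sup>2"
    using of_real_eq_iff by blast
  then show ?thesis by simp
qed

lemma cinner_CS: "cmod (cinner x y) \<le> norm x * norm (y::'a::complex_inner)"
proof (cases "y = 0")
  case False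
  define t where "t = cinner x y / complex_of_real ((norm y)\<^sup>2)"
  have ny: "norm y > 0" using False by simp
  define z where "z = x - t *\<^sub>C y"
  have zy: "cinner z y = 0"
    using ny by (simp add: z_def cinner_diff_left cinner_scaleC_left cinner_self t_def)
  have "cinner x x = cinner (z + t *\<^sub>C y) (z + t *\<^sub>C y)" by (simp add: z_def)
  also have "\<dots> = cinner z z + t * cnj t * cinner y y"
    using zy cinner_commute[of y z]
    by (simp add: cinner_add_left cinner_add_right cinner_scaleC_left cinner_scaleC_right)
  finally have "complex_of_real ((norm x)\<^sup>2) = complex_of_real ((norm z)\<^sup>2 + (cmod t)\<^sup>2 * (norm y)\<^sup>2)"
    by (simp add: cinner_self complex_norm_square[symmetric])
  then have "(norm x)\<^sup>2 = (norm z)\<^sup>2 + (cmod t)\<^sup>2 * (norm y)\<^sup>2"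
    using of_real_eq_iff by blast
  then have "(cmod t * norm y)\<^sup>2 \<le> (norm x)\<^sup>2" by (simp add: power_mult_distrib)
  then have "cmod t * norm y \<le> norm x" by (rule power2_le_imp_le) simp
  moreover have "cmod t * norm y = cmod (cinner x y) / norm y"
    using ny by (simp add: t_def norm_divide norm_power power2_eq_square[of "norm y"] norm_mult)
  ultimately show ?thesis using ny by (simp add: divide_simps)
qed simp

lemma bounded_linear_cinner_left: "bounded_linear (\<lambda>x::'a::complex_inner. cinner x y)"
  by (rule bounded_linear_intro[where K = "norm y"])
    (auto simp: cinner_add_left scaleR_scaleC cinner_scaleC_left cinner_CS scaleR_conv_of_real)

section \<open>Adjoints\<close>

definition clinear_functional :: "('a::complex_inner \<Rightarrow> complex) \<Rightarrow> bool" where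
  "clinear_functional \<phi> \<longleftrightarrow> (\<forall>x y. \<phi> (x + y) = \<phi> x + \<phi> y) \<and> (\<forall>c x. \<phi> (c *\<^sub>C x) = c * \<phi> x) \<and>
     (\<exists>K. \<forall>x. cmod (\<phi> x) \<le> K * norm x)"

lemma clinear_functional_sum:
  assumes "clinear_functional \<phi>" shows "\<phi> (\<Sum>i\<in>A. f i) = (\<Sum>i\<in>A. \<phi> (f i))"
proof -
  have "\<phi> 0 = 0" using assms unfolding clinear_functional_def by (metis scaleC_zero_left mult_zero_left)
  then show ?thesis using assms
    by (induction A rule: infinite_finite_induct) (auto simp: clinear_functional_def)
qed

lemma clinear_functional_bounded_linear: "clinear_functional \<phi> \<Longrightarrow> bounded_linear \<phi>"
proof -
  assume a: "clinear_functional \<phi>"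
  then obtain K where K: "\<And>x. cmod (\<phi> x) \<le> K * norm x" by (auto simp: clinear_functional_def)
  show ?thesis
    by (rule bounded_linear_intro[where K = K])
      (use a K in \<open>auto simp: clinear_functional_def scaleR_scaleC scaleR_conv_of_real mult.commute\<close>)
qed

lemma norm_orthonormal_sum:
  assumes "orthonormal_basis e" "finite A"
  shows "(norm (\<Sum>n\<in>A. a n *\<^sub>C e n))\<^sup>2 = (\<Sum>n\<in>A. (cmod (a n))\<^sup>2)"
proof -
  have "complex_of_real ((norm (\<Sum>n\<in>A. a n *\<^sub>C e n))\<^sup>2) = cinner (\<Sum>n\<in>A. a n *\<^sub>C e n) (\<Sum>n\<in>A. a n *\<^sub>C e n)"
    by (simp add: cinner_self)
  also have "\<dots> = (\<Sum>n\<in>A. \<Sum>m\<in>A. cnj (a m) * (a n * cinner (e n) (e m)))"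
    by (simp only: cinner_sum_left cinner_sum_right cinner_scaleC_left cinner_scaleC_right sum_distrib_left mult_ac)
      (rule sum.swap)
  also have "\<dots> = (\<Sum>n\<in>A. \<Sum>m\<in>A. if n = m then cnj (a n) * a n else 0)"
    using assms by (intro sum.cong) (auto simp: orthonormal_basis_def)
  also have "\<dots> = complex_of_real (\<Sum>n\<in>A. (cmod (a n))\<^sup>2)"
    using assms(2) by (simp add: complex_norm_square mult.commute del: of_real_power)
  finally show ?thesis using of_real_eq_iff by blast
qed

text \<open>On the combination of basis vectors with coefficients \<open>cnj (\<phi> (e n))\<close>
  the functional takes the value \<open>q\<close>, the square sum itself, while that vector has norm
  \<open>sqrt q\<close>. Hence \<open>q \<le> K * sqrt q\<close>, so every partial sum is at most
  \<open>K\<^sup>2\<close>.\<close>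

lemma functional_square_summable:
  assumes e: "orthonormal_basis e" and f: "clinear_functional \<phi>"
  shows "summable (\<lambda>n. (cmod (\<phi> (e n)))\<^sup>2)"
proof -
  obtain K where K: "\<And>x. cmod (\<phi> x) \<le> K * norm x" using f by (auto simp: clinear_functional_def)
  have "(\<Sum>n<N. (cmod (\<phi> (e n)))\<^sup>2) \<le> K\<^sup>2" for N
  proof -
    define q where "q = (\<Sum>n<N. (cmod (\<phi> (e n)))\<^sup>2)"
    define v where "v = (\<Sum>n<N. cnj (\<phi> (e n)) *\<^sub>C e n)"
    have q0: "q \<ge> 0" by (simp add: q_def sum_nonneg)
    have "\<phi> v = complex_of_real q"
      using f by (simp add: v_def q_def clinear_functional_sum[OF f] clinear_functional_def
          complex_norm_square mult.commute del: of_real_power)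
    moreover have "(norm v)\<^sup>2 = q"
      using norm_orthonormal_sum[OF e, of "{..<N}" "\<lambda>n. cnj (\<phi> (e n))"] by (simp add: v_def q_def)
    moreover from this have "norm v = sqrt q" by (simp add: real_sqrt_unique)
    ultimately have "q \<le> K * sqrt q" using K[of v] q0 by simp
    then have "q * q \<le> (K * sqrt q) * (K * sqrt q)" using q0 by (intro mult_mono) auto
    also have "\<dots> = K\<^sup>2 * q" using q0 by (simp add: power2_eq_square mult_ac)
    finally show ?thesis unfolding q_def[symmetric] using q0
      by (cases "q = 0") auto
  qed
  then show ?thesis by (intro summableI_nonneg_bounded[where x = "K\<^sup>2"]) auto
qed

text \<open>A Cauchy criterion for estimates that control squares of partial sums; it serves both
  orthonormal series and the rows of block matrices.\<close>

lemma summable_of_square_bound: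
  fixes f :: "nat \<Rightarrow> 'a::{real_normed_vector, complete_space}"
  assumes f: "\<And>m n. (norm (sum f {m..<n}))\<^sup>2 \<le> B * sum b {m..<n}"
    and b: "summable b" and B: "B \<ge> 0" and b0: "\<And>n. 0 \<le> b n"
  shows "summable f"
proof -
  have "Cauchy (\<lambda>n. \<Sum>i<n. f i)"
  proof (rule CauchyI')
    fix r :: real assume r: "r > 0"
    \<comment> \<open>Using \<open>B + 1\<close> keeps the denominator positive when
      \<open>B = 0\<close>.\<close>
    have "r\<^sup>2 / (B + 1) > 0" using r B by simp
    then obtain M where M: "\<And>m n. m \<ge> M \<Longrightarrow> norm (sum b {m..<n}) < r\<^sup>2 / (B + 1)"
      using b unfolding summable_Cauchy by meson
    have "dist (\<Sum>i<m. f i) (\<Sum>i<n. f i) < r" if "m \<ge> M" "m < n" for m n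
    proof -
      have "(\<Sum>i<n. f i) - (\<Sum>i<m. f i) = sum f {m..<n}"
        using that sum_diff_nat_ivl[of 0 m n f] by (simp add: atLeast0LessThan)
      then have "(dist (\<Sum>i<m. f i) (\<Sum>i<n. f i))\<^sup>2 \<le> B * sum b {m..<n}"
        using f[of m n] by (subst dist_commute) (simp add: dist_norm)
      also have "\<dots> \<le> (B + 1) * sum b {m..<n}"
        using b0 by (intro mult_right_mono sum_nonneg) auto
      also have "\<dots> < r\<^sup>2"
        using M[OF that(1), of n] B by (simp add: sum_nonneg b0 pos_less_divide_eq mult.commute)
      finally show ?thesis using r by (simp add: power_less_imp_less_base less_imp_le)
    qed
    then show "\<exists>M. \<forall>m\<ge>M. \<forall>n>m. dist (\<Sum>i<m. f i) (\<Sum>i<n. f i) < r" by blast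
  qed
  then show ?thesis
    using Cauchy_convergent by (auto simp: summable_def sums_def convergent_def)
qed

lemma orthonormal_series_convergent:
  fixes e :: "nat \<Rightarrow> 'a::{complex_inner, complete_space}"
  assumes e: "orthonormal_basis e" and a: "summable (\<lambda>n. (cmod (a n))\<^sup>2)"
  shows "summable (\<lambda>n. a n *\<^sub>C e n)"
  by (rule summable_of_square_bound[OF _ a, of _ 1]) (simp_all add: norm_orthonormal_sum[OF e])

text \<open>\<open>orthonormal_basis\<close> encodes completeness as totality, so the expansion has
  to be derived: the series converges because its coefficients are square-summable, and
  \<open>x\<close> minus its sum is orthogonal to every \<open>e m\<close>, hence zero.\<close>

lemma orthonormal_expansion:
  fixes e :: "nat \<Rightarrow> 'a::{complex_inner, complete_space}"
  assumes e: "orthonormal_basis e"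
  shows "(\<lambda>n. cinner x (e n) *\<^sub>C e n) sums x"
proof -
  have "clinear_functional (\<lambda>z. cinner z x)"
    unfolding clinear_functional_def
    using cinner_CS[of _ x] by (auto simp: cinner_add_left cinner_scaleC_left mult.commute intro!: exI[of _ "norm x"])
  from functional_square_summable[OF e this]
  have "summable (\<lambda>n. (cmod (cinner x (e n)))\<^sup>2)"
    using cinner_commute[of x] by simp
  then have s: "summable (\<lambda>n. cinner x (e n) *\<^sub>C e n)" (is "summable ?f")
    by (rule orthonormal_series_convergent[OF e])
  have "cinner (suminf ?f) (e m) = cinner x (e m)" for m
  proof -
    have "(\<lambda>n. cinner (?f n) (e m)) sums cinner (suminf ?f) (e m)"
      using bounded_linear.sums[OF bounded_linear_cinner_left summable_sums[OF s]] .
    moreover have "(\<lambda>n. cinner (?f n) (e m)) = (\<lambda>n. if n = m then cinner x (e m) else 0)"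
      using e by (auto simp: orthonormal_basis_def cinner_scaleC_left)
    ultimately show ?thesis
      using sums_unique2[OF _ sums_single[of m "\<lambda>_. cinner x (e m)"]] by simp
  qed
  then have "\<forall>m. cinner (x - suminf ?f) (e m) = 0" by (simp add: cinner_diff_left)
  then have "x - suminf ?f = 0" using e unfolding orthonormal_basis_def by blast
  then show ?thesis using summable_sums[OF s] by simp
qed

text \<open>The representing vector is the series with coefficients
  \<open>cnj (\<phi> (e n))\<close>; two continuous functionals that agree on the basis agree on
  every expansion.\<close>

lemma riesz_representation:
  fixes e :: "nat \<Rightarrow> 'a::{complex_inner, complete_space}" and \<phi> :: "'a \<Rightarrow> complex"
  assumes e: "orthonormal_basis e" and f: "clinear_functional \<phi>"
  shows "\<exists>w. \<forall>x. \<phi> x = cinner x w"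
proof -
  have s: "summable (\<lambda>n. cnj (\<phi> (e n)) *\<^sub>C e n)"
    using functional_square_summable[OF e f] by (intro orthonormal_series_convergent[OF e]) simp
  define w where "w = (\<Sum>n. cnj (\<phi> (e n)) *\<^sub>C e n)"
  have ew: "cinner (e m) w = \<phi> (e m)" for m
  proof -
    have "(\<lambda>n. cinner (cnj (\<phi> (e n)) *\<^sub>C e n) (e m)) sums cinner w (e m)"
      using bounded_linear.sums[OF bounded_linear_cinner_left summable_sums[OF s]] by (simp add: w_def)
    moreover have "(\<lambda>n. cinner (cnj (\<phi> (e n)) *\<^sub>C e n) (e m)) = (\<lambda>n. if n = m then cnj (\<phi> (e m)) else 0)"
      using e by (auto simp: orthonormal_basis_def cinner_scaleC_left)
    ultimately have "cinner w (e m) = cnj (\<phi> (e m))"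
      using sums_unique2[OF _ sums_single[of m "\<lambda>_. cnj (\<phi> (e m))"]] by simp
    then show ?thesis by (metis cinner_commute complex_cnj_cnj)
  qed
  have "\<phi> x = cinner x w" for x
  proof -
    note x = orthonormal_expansion[OF e, of x]
    have "(\<lambda>n. \<phi> (cinner x (e n) *\<^sub>C e n)) sums \<phi> x"
      by (rule bounded_linear.sums[OF clinear_functional_bounded_linear[OF f] x])
    moreover have "(\<lambda>n. cinner (cinner x (e n) *\<^sub>C e n) w) sums cinner x w"
      by (rule bounded_linear.sums[OF bounded_linear_cinner_left x])
    moreover have "\<phi> (cinner x (e n) *\<^sub>C e n) = cinner (cinner x (e n) *\<^sub>C e n) w" for n
      using f by (simp add: clinear_functional_def cinner_scaleC_left ew)
    ultimately show ?thesis by (simp add: sums_unique2)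
  qed
  then show ?thesis by blast
qed

text \<open>\<open>cadjoint\<close> is a choice, so its characteristic property is available only
  once some adjoint is known to exist. Riesz representation supplies one, pointwise in
  \<open>y\<close>.\<close>

lemma cadjoint_cinner:
  fixes e :: "nat \<Rightarrow> 'a::{complex_inner, complete_space}" and A :: "'a \<Rightarrow> 'a"
  assumes e: "orthonormal_basis e" and A: "bounded_clinear_op A"
  shows "cinner (A x) y = cinner x (cadjoint A y)"
proof -
  obtain K where K: "\<And>x. norm (A x) \<le> K * norm x" using A by (auto simp: bounded_clinear_op_def)
  have "clinear_functional (\<lambda>x. cinner (A x) y)" for y
  proof -
    have "cmod (cinner (A x) y) \<le> (K * norm y) * norm x" for x
    proof -
      have "cmod (cinner (A x) y) \<le> norm (A x) * norm y" by (rule cinner_CS)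
      also have "\<dots> \<le> (K * norm x) * norm y" using K by (intro mult_right_mono) auto
      finally show ?thesis by (simp add: mult_ac)
    qed
    then show ?thesis using A
      by (auto simp: clinear_functional_def bounded_clinear_op_def cinner_add_left cinner_scaleC_left)
  qed
  then have "\<exists>w. \<forall>x. cinner (A x) y = cinner x w" for y
    using riesz_representation[OF e, of "\<lambda>x. cinner (A x) y"] by simp
  then have "\<exists>B. \<forall>x y. cinner (A x) y = cinner x (B y)" by metis
  then show ?thesis unfolding cadjoint_def by (rule someI2_ex) blast
qed

section \<open>Convolution with anticommuting coefficients\<close>

text \<open>The window is wide enough to contain the translated support, so finite sums behave like
  translation-invariant sums over all integers.\<close>

lemma sum_shift_support:
  fixes g :: "int \<Rightarrow> 'b::comm_monoid_add"
  assumes "\<And>m. m \<notin> {-L..L} \<Longrightarrow> g m = 0" "\<bar>s\<bar> + L \<le> M"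
  shows "(\<Sum>m\<in>{-M..M}. g (m + s)) = (\<Sum>m\<in>{-L..L}. g m)"
proof -
  have "(\<Sum>m\<in>{-M..M}. g (m + s)) = (\<Sum>m\<in>{-M+s..M+s}. g m)"
    by (rule sum.reindex_bij_witness[of _ "\<lambda>m. m - s" "\<lambda>m. m + s"]) auto
  also have "\<dots> = (\<Sum>m\<in>{-L..L}. g m)"
    using assms by (intro sum.mono_neutral_right) auto
  finally show ?thesis .
qed

text \<open>Translating the first sum by \<open>k\<close> and the second by \<open>l\<close> in the
  opposite direction brings both to the arguments \<open>m\<close> and \<open>m + l - k\<close>;
  then \<open>anti\<close> removes every pair with \<open>k \<noteq> l\<close>. The forms
  \<open>A\<close> and \<open>A'\<close> stay abstract because the identity is applied twice: to the
  operators \<open>C k\<close>, and to their matrix model on subsets combined with a defect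
  form.\<close>

lemma anticommuting_convolution_identity:
  fixes A A' :: "nat \<Rightarrow> int \<Rightarrow> nat \<Rightarrow> int \<Rightarrow> complex" and c :: "nat \<Rightarrow> complex"
  assumes anti: "\<And>k l m n. k < d \<Longrightarrow> l < d \<Longrightarrow> A k m l n + A' l m k n = (if k = l then G m n else 0)"
    and A0: "\<And>k l m n. m \<notin> {-L..L} \<Longrightarrow> A k m l n = 0"
    and A'0: "\<And>k l m n. m \<notin> {-L..L} \<Longrightarrow> A' k m l n = 0"
    and M: "L + int d \<le> M"
  shows "(\<Sum>m\<in>{-M..M}. \<Sum>k<d. \<Sum>l<d. c k * cnj (c l) * A k (m + int k) l (m + int l)) +
      (\<Sum>m\<in>{-M..M}. \<Sum>k<d. \<Sum>l<d. c k * cnj (c l) * A' l (m - int l) k (m - int k)) =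
      (\<Sum>k<d. complex_of_real ((cmod (c k))\<^sup>2)) * (\<Sum>m\<in>{-L..L}. G m m)"
proof -
  have 1: "(\<Sum>m\<in>{-M..M}. A k (m + int k) l (m + int l)) = (\<Sum>m\<in>{-L..L}. A k m l (m + int l - int k))"
    if "k < d" for k l
    using sum_shift_support[of L "\<lambda>m. A k m l (m + int l - int k)" "int k" M] A0 M that
    by (simp add: algebra_simps)
  have 2: "(\<Sum>m\<in>{-M..M}. A' l (m - int l) k (m - int k)) = (\<Sum>m\<in>{-L..L}. A' l m k (m + int l - int k))"
    if "l < d" for k l
    using sum_shift_support[of L "\<lambda>m. A' l m k (m + int l - int k)" "- int l" M] A'0 M that
    by (simp add: algebra_simps)
  have swap: "(\<Sum>m\<in>{-M..M}. \<Sum>k<d. \<Sum>l<d. c k * cnj (c l) * F k l m) =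
      (\<Sum>k<d. \<Sum>l<d. c k * cnj (c l) * (\<Sum>m\<in>{-M..M}. F k l m))" for F
    by (simp add: sum_distrib_left) (subst sum.swap, intro sum.cong refl, rule sum.swap)
  have "(\<Sum>m\<in>{-M..M}. \<Sum>k<d. \<Sum>l<d. c k * cnj (c l) * A k (m + int k) l (m + int l)) +
      (\<Sum>m\<in>{-M..M}. \<Sum>k<d. \<Sum>l<d. c k * cnj (c l) * A' l (m - int l) k (m - int k)) =
      (\<Sum>k<d. \<Sum>l<d. c k * cnj (c l) *
        (\<Sum>m\<in>{-L..L}. A k m l (m + int l - int k) + A' l m k (m + int l - int k)))"
    unfolding swap sum.distrib distrib_left by (simp add: 1 2)
  also have "\<dots> = (\<Sum>k<d. \<Sum>l<d. if k = l then c k * cnj (c k) * (\<Sum>m\<in>{-L..L}. G m m) else 0)"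
    by (intro sum.cong refl) (auto simp: anti)
  also have "\<dots> = (\<Sum>k<d. c k * cnj (c k) * (\<Sum>m\<in>{-L..L}. G m m))"
    by simp
  finally show ?thesis
    by (simp add: sum_distrib_right complex_norm_square del: of_real_power)
qed

text \<open>The adjoints are a second parameter, characterised by \<open>adj\<close>;
  \<open>cadjoint\<close> enters only when the locale is interpreted.\<close>

locale car_family =
  fixes C D :: "nat \<Rightarrow> 'a::complex_inner \<Rightarrow> 'a"
  assumes C_add: "C k (x + y) = C k x + C k y"
    and C_scaleC: "C k (a *\<^sub>C x) = a *\<^sub>C C k x"
    and adj: "cinner (C k x) y = cinner x (D k y)"
    and CC: "C k (C l x) + C l (C k x) = 0"
    and CD: "C k (D l x) + D l (C k x) = (if k = l then x else 0)"
begin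

lemma adj': "cinner (D k x) y = cinner x (C k y)"
  by (metis adj cinner_commute)

lemma D_scaleC: "D k (a *\<^sub>C x) = a *\<^sub>C D k x"
proof -
  let ?w = "D k (a *\<^sub>C x) - a *\<^sub>C D k x"
  have "cinner ?w y = 0" for y
    by (simp add: cinner_diff_left adj' cinner_scaleC_left)
  then have "?w = 0" using cinner_eq_zero_iff by blast
  then show ?thesis by simp
qed

lemma C_0 [simp]: "C k 0 = 0"
  using C_scaleC[of k 0 0] by simp

lemma D_0 [simp]: "D k 0 = 0"
  using D_scaleC[of k 0 0] by simp

lemma norm_C_D: "(norm (C k x))\<^sup>2 + (norm (D k x))\<^sup>2 = (norm x)\<^sup>2"
proof -
  have "cinner (C k x) (C k x) + cinner (D k x) (D k x) = cinner (C k (D k x) + D k (C k x)) x"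
    by (simp add: adj adj' cinner_add_left)
  also have "\<dots> = cinner x x" by (simp add: CD)
  finally have "complex_of_real ((norm (C k x))\<^sup>2 + (norm (D k x))\<^sup>2) = complex_of_real ((norm x)\<^sup>2)"
    by (simp add: cinner_self)
  then show ?thesis using of_real_eq_iff by blast
qed

lemma norm_C_le: "norm (C k x) \<le> norm x"
proof (rule power2_le_imp_le)
  show "(norm (C k x))\<^sup>2 \<le> (norm x)\<^sup>2"
    using norm_C_D[of k x] zero_le_power2[of "norm (D k x)"] by linarith
qed simp

text \<open>\<open>y\<close> and \<open>y'\<close> are the images of \<open>z\<close> under
  convolution with the operators \<open>c k\<close> times \<open>C k\<close> and under the adjoint
  of this convolution. Their square norms add up exactly to the right-hand side, and discarding
  \<open>y'\<close> leaves the bound.\<close>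

lemma convolution_bound:
  fixes z :: "int \<Rightarrow> 'a"
  assumes z: "\<And>m. m \<notin> {-L..L} \<Longrightarrow> z m = 0" and M: "L + int d \<le> M"
  shows "(\<Sum>m\<in>{-M..M}. (norm (\<Sum>k<d. c k *\<^sub>C C k (z (m + int k))))\<^sup>2)
    \<le> (\<Sum>k<d. (cmod (c k))\<^sup>2) * (\<Sum>m\<in>{-L..L}. (norm (z m))\<^sup>2)"
proof -
  define A where "A k m l n = cinner (C k (z m)) (C l (z n))" for k m l n
  define A' where "A' k m l n = cinner (D k (z m)) (D l (z n))" for k m l n
  define y where "y m = (\<Sum>k<d. c k *\<^sub>C C k (z (m + int k)))" for m
  define y' where "y' m = (\<Sum>k<d. cnj (c k) *\<^sub>C D k (z (m - int k)))" for m
  have "A k m l n + A' l m k n = cinner (D l (C k (z m)) + C k (D l (z m))) (z n)" for k l m n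
    by (simp add: A_def A'_def adj adj' cinner_add_left)
  then have anti: "A k m l n + A' l m k n = (if k = l then cinner (z m) (z n) else 0)" for k l m n
    using CD[of k l "z m"] by (simp add: add.commute)
  have "cinner (y m) (y m) = (\<Sum>k<d. \<Sum>l<d. c k * cnj (c l) * A k (m + int k) l (m + int l))" for m
    by (simp only: y_def A_def cinner_sum_left cinner_sum_right cinner_scaleC_left cinner_scaleC_right
        sum_distrib_left mult_ac) (rule sum.swap)
  moreover have "cinner (y' m) (y' m) = (\<Sum>k<d. \<Sum>l<d. c k * cnj (c l) * A' l (m - int l) k (m - int k))" for m
    by (simp only: y'_def A'_def cinner_sum_left cinner_sum_right cinner_scaleC_left cinner_scaleC_right
        sum_distrib_left mult_ac complex_cnj_cnj)
  moreover have "A k m l n = 0" "A' k m l n = 0" if "m \<notin> {-L..L}" for k l m n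
    using z[OF that] by (simp_all add: A_def A'_def)
  note anticommuting_convolution_identity[OF anti this M, where c = c]
  ultimately have "(\<Sum>m\<in>{-M..M}. cinner (y m) (y m)) + (\<Sum>m\<in>{-M..M}. cinner (y' m) (y' m)) =
      (\<Sum>k<d. complex_of_real ((cmod (c k))\<^sup>2)) * (\<Sum>m\<in>{-L..L}. cinner (z m) (z m))"
    by simp
  then have "complex_of_real ((\<Sum>m\<in>{-M..M}. (norm (y m))\<^sup>2) + (\<Sum>m\<in>{-M..M}. (norm (y' m))\<^sup>2)) =
     complex_of_real ((\<Sum>k<d. (cmod (c k))\<^sup>2) * (\<Sum>m\<in>{-L..L}. (norm (z m))\<^sup>2))"
    by (simp add: cinner_self)
  then have "(\<Sum>m\<in>{-M..M}. (norm (y m))\<^sup>2) + (\<Sum>m\<in>{-M..M}. (norm (y' m))\<^sup>2) =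
      (\<Sum>k<d. (cmod (c k))\<^sup>2) * (\<Sum>m\<in>{-L..L}. (norm (z m))\<^sup>2)"
    using of_real_eq_iff by blast
  moreover have "0 \<le> (\<Sum>m\<in>{-M..M}. (norm (y' m))\<^sup>2)" by (simp add: sum_nonneg)
  ultimately show ?thesis by (simp add: y_def)
qed

text \<open>With \<open>x\<close> extended by zero to the integers, row \<open>i\<close> of the
  Hankel matrix is the convolution evaluated at \<open>- i\<close>. The rows are thus part of a
  convolution and inherit its bound.\<close>

lemma Hankel_bound:
  fixes x :: "nat \<Rightarrow> 'a"
  shows "(\<Sum>i<N. (norm (\<Sum>j<n. c (i + j) *\<^sub>C C (i + j) (x j)))\<^sup>2)
    \<le> (\<Sum>k<N+n. (cmod (c k))\<^sup>2) * (\<Sum>j<n. (norm (x j))\<^sup>2)"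
proof -
  define z where "z m = (if 0 \<le> m \<and> m < int n then x (nat m) else 0)" for m :: int
  define M where "M = int n + int (N + n)"
  define y where "y m = (\<Sum>k<N+n. c k *\<^sub>C C k (z (m + int k)))" for m
  have y: "y (- int i) = (\<Sum>j<n. c (i + j) *\<^sub>C C (i + j) (x j))" if "i < N" for i
  proof -
    have "y (- int i) = (\<Sum>k\<in>{i..<i+n}. c k *\<^sub>C C k (z (- int i + int k)))"
      unfolding y_def using that by (intro sum.mono_neutral_right) (auto simp: z_def)
    also have "\<dots> = (\<Sum>j<n. c (i + j) *\<^sub>C C (i + j) (x j))"
      by (rule sum.reindex_bij_witness[of _ "\<lambda>j. i + j" "\<lambda>k. k - i"]) (auto simp: z_def nat_diff_distrib)
    finally show ?thesis .
  qed
  have "(\<Sum>i<N. (norm (\<Sum>j<n. c (i + j) *\<^sub>C C (i + j) (x j)))\<^sup>2) = (\<Sum>i<N. (norm (y (- int i)))\<^sup>2)"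
    by (intro sum.cong) (auto simp: y)
  also have "\<dots> = (\<Sum>m\<in>(\<lambda>i. - int i) ` {..<N}. (norm (y m))\<^sup>2)"
    by (subst sum.reindex) (auto simp: inj_on_def)
  also have "\<dots> \<le> (\<Sum>m\<in>{-M..M}. (norm (y m))\<^sup>2)"
    by (intro sum_mono2) (auto simp: M_def)
  also have "\<dots> \<le> (\<Sum>k<N+n. (cmod (c k))\<^sup>2) * (\<Sum>m\<in>{-int n..int n}. (norm (z m))\<^sup>2)"
    unfolding y_def by (rule convolution_bound) (auto simp: z_def M_def)
  also have "(\<Sum>m\<in>{-int n..int n}. (norm (z m))\<^sup>2) = (\<Sum>m\<in>int ` {..<n}. (norm (z m))\<^sup>2)"
  proof (rule sum.mono_neutral_right)
    show "\<forall>m\<in>{-int n..int n} - int ` {..<n}. (norm (z m))\<^sup>2 = 0"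
    proof
      fix m assume "m \<in> {-int n..int n} - int ` {..<n}"
      then have "\<not> (0 \<le> m \<and> m < int n)" by (cases m) auto
      then show "(norm (z m))\<^sup>2 = 0" by (auto simp: z_def)
    qed
  qed auto
  also have "\<dots> = (\<Sum>j<n. (norm (x j))\<^sup>2)"
    by (subst sum.reindex) (auto simp: z_def)
  finally show ?thesis .
qed

end

section \<open>Weighted Hankel matrices\<close>

lemma L2_set_sum_le:
  "L2_set (\<lambda>i. \<Sum>b\<in>B. f b i) I \<le> (\<Sum>b\<in>B. L2_set (f b) I)"
proof (induction B rule: infinite_finite_induct)
  case (insert b B)
  have "L2_set (\<lambda>i. f b i + (\<Sum>b\<in>B. f b i)) I \<le> L2_set (f b) I + L2_set (\<lambda>i. \<Sum>b\<in>B. f b i) I"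
    by (rule L2_set_triangle_ineq)
  then show ?case using insert by simp
qed (auto simp: L2_set_def)

text \<open>A geometric sum is dominated by its last term, here a multiple of
  \<open>4 ^ floor_log q\<close>, which is at most the square of \<open>q\<close>.\<close>

lemma sum_power4_le:
  assumes "q > 0"
  shows "(\<Sum>b<n. if 2 ^ b \<le> q then 4 ^ Suc b else (0::real)) \<le> 8 * (real q)\<^sup>2"
proof -
  have "b \<le> floor_log q" if "2 ^ b \<le> q" for b
    using floor_log_le_iff[OF that] by simp
  then have "(\<Sum>b<n. if 2 ^ b \<le> q then 4 ^ Suc b else (0::real)) \<le> (\<Sum>b\<le>floor_log q. 4 ^ Suc b)"
    by (simp only: sum.inter_filter[symmetric] finite_lessThan) (intro sum_mono2, auto)
  also have "(\<Sum>b\<le>m. (4::real) ^ Suc b) \<le> 8 * 4 ^ m" for m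
  proof (induction m)
    case (Suc m)
    have "(\<Sum>b\<le>Suc m. (4::real) ^ Suc b) = (\<Sum>b\<le>m. 4 ^ Suc b) + 16 * 4 ^ m" "8 * (4::real) ^ Suc m = 32 * 4 ^ m"
      "0 \<le> (4::real) ^ m" by simp_all
    then show ?case using Suc by linarith
  qed simp
  also have "(4::real) ^ floor_log q = (real (2 ^ floor_log q))\<^sup>2"
    by (simp add: power2_eq_square power_mult_distrib[symmetric])
  also have "\<dots> \<le> (real q)\<^sup>2"
    using floor_log_exp2_le[OF assms] by (intro power_mono) (auto simp del: of_nat_power)
  finally show ?thesis by simp
qed

context car_family begin

text \<open>Columns are grouped dyadically: on the block \<open>2 ^ b \<le> j + 1 < 2 ^ (b + 1)\<close> the weight is
  essentially constant and only the coefficients with \<open>k + 1 \<ge> 2 ^ b\<close> occur.\<close>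

lemma weighted_Hankel_bound:
  assumes S: "\<And>K. (\<Sum>k<K. (real (Suc k) * cmod (\<alpha> k))\<^sup>2) \<le> S"
  shows "(\<Sum>i<N. (norm (\<Sum>j<n. (of_nat (Suc j) * \<alpha> (i + j)) *\<^sub>C C (i + j) (x j)))\<^sup>2)
    \<le> 8 * S * (\<Sum>j<n. (norm (x j))\<^sup>2)"
proof -
  define lg where "lg j = floor_log (Suc j)" for j
  have lg1: "2 ^ lg j \<le> Suc j" and lg2: "Suc j < 2 * 2 ^ lg j" for j
    using floor_log_exp2_le[of "Suc j"] floor_log_exp2_gt[of "Suc j"] by (auto simp: lg_def)
  have lgn: "lg j < n" if "j < n" for j
  proof -
    have "(2::nat) ^ lg j < 2 ^ n" using lg1[of j] that less_exp[of n] by linarith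
    then show ?thesis by simp
  qed
  \<comment> \<open>A column of block \<open>b\<close> only meets indices with
    \<open>2 ^ b \<le> Suc (i + j)\<close>, so the truncation changes no entry of the block, but it
    makes \<open>t b\<close> decay with \<open>b\<close>.\<close>
  define c where "c b k = (if 2 ^ b \<le> Suc k then \<alpha> k else 0)" for b k
  define xb where "xb b j = (if lg j = b then of_nat (Suc j) *\<^sub>C x j else 0)" for b j
  define Y where "Y b i = (\<Sum>j<n. c b (i + j) *\<^sub>C C (i + j) (xb b j))" for b i
  define X where "X b = (\<Sum>j<n. if lg j = b then (norm (x j))\<^sup>2 else 0)" for b
  define t where "t b = (\<Sum>k<N+n. (cmod (c b k))\<^sup>2)" for b
  have X0: "X b \<ge> 0" and t0: "t b \<ge> 0" for b by (simp_all add: X_def t_def sum_nonneg)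
  have row: "(\<Sum>j<n. (of_nat (Suc j) * \<alpha> (i + j)) *\<^sub>C C (i + j) (x j)) = (\<Sum>b<n. Y b i)" for i
  proof -
    have "c b (i + j) *\<^sub>C C (i + j) (xb b j) =
        (if lg j = b then (of_nat (Suc j) * \<alpha> (i + j)) *\<^sub>C C (i + j) (x j) else 0)" for b j
    proof (cases "lg j = b")
      case True
      have "2 ^ b \<le> Suc (i + j)" using lg1[of j] True by simp
      then show ?thesis using True
        by (simp add: c_def xb_def C_scaleC scaleC_scaleC mult.commute del: of_nat_Suc)
    qed (simp add: xb_def)
    then have "(\<Sum>b<n. Y b i) =
        (\<Sum>j<n. \<Sum>b<n. if lg j = b then (of_nat (Suc j) * \<alpha> (i + j)) *\<^sub>C C (i + j) (x j) else 0)"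
      unfolding Y_def by (subst sum.swap) (simp del: of_nat_Suc)
    also have "\<dots> = (\<Sum>j<n. (of_nat (Suc j) * \<alpha> (i + j)) *\<^sub>C C (i + j) (x j))"
      by (intro sum.cong refl) (auto simp: lgn simp del: of_nat_Suc)
    finally show ?thesis by simp
  qed
  \<comment> \<open>\<open>Hankel_bound\<close> contributes \<open>t b\<close>; the weight is at
    most \<open>2 ^ Suc b\<close> on the block, which costs \<open>4 ^ Suc b\<close> after
    squaring.\<close>
  have blk: "L2_set (\<lambda>i. norm (Y b i)) {..<N} \<le> sqrt (4 ^ Suc b * t b) * sqrt (X b)" for b
  proof -
    have "(\<Sum>i<N. (norm (Y b i))\<^sup>2) \<le> t b * (\<Sum>j<n. (norm (xb b j))\<^sup>2)"
      unfolding Y_def t_def by (rule Hankel_bound)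
    also have "(\<Sum>j<n. (norm (xb b j))\<^sup>2) \<le> (\<Sum>j<n. 4 ^ Suc b * (if lg j = b then (norm (x j))\<^sup>2 else 0))"
    proof (rule sum_mono)
      fix j
      have "(norm (xb b j))\<^sup>2 \<le> 4 ^ Suc b * (norm (x j))\<^sup>2" if "lg j = b"
      proof -
        have "real (Suc j) \<le> 2 ^ Suc b"
          using lg2[of j] that by (metis less_imp_le of_nat_le_iff of_nat_numeral of_nat_power power_Suc)
        then have "(real (Suc j))\<^sup>2 \<le> (2 ^ Suc b)\<^sup>2" by (intro power_mono) auto
        also have "((2::real) ^ Suc b)\<^sup>2 = 4 ^ Suc b"
          by (simp add: power2_eq_square power_mult_distrib[symmetric])
        finally show ?thesis using that
          by (simp add: xb_def norm_scaleC power_mult_distrib mult_right_mono del: of_nat_Suc)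
      qed
      then show "(norm (xb b j))\<^sup>2 \<le> 4 ^ Suc b * (if lg j = b then (norm (x j))\<^sup>2 else 0)"
        by (simp add: xb_def)
    qed
    also have "\<dots> = 4 ^ Suc b * X b" by (simp only: X_def sum_distrib_left)
    finally have "(\<Sum>i<N. (norm (Y b i))\<^sup>2) \<le> (4 ^ Suc b * t b) * X b"
      using t0[of b] by (simp add: mult_ac mult_right_mono)
    then show ?thesis unfolding L2_set_def real_sqrt_mult[symmetric] by (rule real_sqrt_le_mono)
  qed
  \<comment> \<open>After exchanging the sums, index \<open>k\<close> collects the powers
    \<open>4 ^ Suc b\<close> with \<open>2 ^ b \<le> Suc k\<close>, and these reproduce the squared
    weight \<open>Suc k\<close> up to the factor 8.\<close>
  have tS: "(\<Sum>b<n. 4 ^ Suc b * t b) \<le> 8 * S"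
  proof -
    have "(\<Sum>b<n. 4 ^ Suc b * t b) =
        (\<Sum>k<N+n. (cmod (\<alpha> k))\<^sup>2 * (\<Sum>b<n. if 2 ^ b \<le> Suc k then 4 ^ Suc b else 0))"
      unfolding t_def sum_distrib_left
      by (subst sum.swap) (auto simp: c_def mult_ac intro!: sum.cong)
    also have "\<dots> \<le> (\<Sum>k<N+n. (cmod (\<alpha> k))\<^sup>2 * (8 * (real (Suc k))\<^sup>2))"
      by (intro sum_mono mult_left_mono sum_power4_le) auto
    also have "\<dots> = 8 * (\<Sum>k<N+n. (real (Suc k) * cmod (\<alpha> k))\<^sup>2)"
      by (simp add: sum_distrib_left power_mult_distrib mult_ac del: of_nat_Suc)
    also have "\<dots> \<le> 8 * S" using S[of "N+n"] by simp
    finally show ?thesis .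
  qed
  have XX: "(\<Sum>b<n. X b) = (\<Sum>j<n. (norm (x j))\<^sup>2)"
    unfolding X_def by (subst sum.swap) (auto simp: lgn intro!: sum.cong)
  \<comment> \<open>The blocks share their rows, so they are combined by the triangle inequality,
    followed by Cauchy-Schwarz in \<open>b\<close>.\<close>
  have "L2_set (\<lambda>i. norm (\<Sum>b<n. Y b i)) {..<N} \<le> L2_set (\<lambda>i. \<Sum>b<n. norm (Y b i)) {..<N}"
    by (intro L2_set_mono norm_sum) auto
  also have "\<dots> \<le> (\<Sum>b<n. L2_set (\<lambda>i. norm (Y b i)) {..<N})"
    by (rule L2_set_sum_le)
  also have "\<dots> \<le> (\<Sum>b<n. \<bar>sqrt (4 ^ Suc b * t b)\<bar> * \<bar>sqrt (X b)\<bar>)"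
    using blk X0 t0 by (intro sum_mono) simp
  also have "\<dots> \<le> L2_set (\<lambda>b. sqrt (4 ^ Suc b * t b)) {..<n} * L2_set (\<lambda>b. sqrt (X b)) {..<n}"
    by (rule L2_set_mult_ineq)
  also have "\<dots> = sqrt ((\<Sum>b<n. 4 ^ Suc b * t b) * (\<Sum>b<n. X b))"
    using X0 t0 by (simp add: L2_set_def real_sqrt_mult power_mult_distrib)
  also have "\<dots> \<le> sqrt (8 * S * (\<Sum>j<n. (norm (x j))\<^sup>2))"
    unfolding XX using tS by (intro real_sqrt_le_mono mult_right_mono) (auto intro: sum_nonneg)
  finally show ?thesis unfolding row by (simp add: L2_set_def)
qed

end

section \<open>Square-summable sequences\<close>

lemma l2_iff: "x \<in> l2 \<longleftrightarrow> summable (\<lambda>n. (norm (x n))\<^sup>2)"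
  by (simp add: l2_def)

lemma l2_zero [simp]: "(\<lambda>k. 0) \<in> l2"
  by (simp add: l2_def)

lemma norm_add_square_le:
  "(norm (x + y))\<^sup>2 \<le> 2 * (norm x)\<^sup>2 + 2 * (norm (y::'a::real_normed_vector))\<^sup>2"
proof -
  have "(norm (x + y))\<^sup>2 \<le> (norm x + norm y)\<^sup>2"
    by (intro power_mono norm_triangle_ineq) simp
  also have "\<dots> \<le> 2 * (norm x)\<^sup>2 + 2 * (norm y)\<^sup>2"
    using sum_squares_bound[of "norm x" "norm y"] by (simp add: power2_sum)
  finally show ?thesis .
qed

lemma l2_add:
  assumes "x \<in> l2" "y \<in> l2" shows "(\<lambda>n. x n + y n) \<in> l2"
proof -
  have "summable (\<lambda>n. 2 * (norm (x n))\<^sup>2 + 2 * (norm (y n))\<^sup>2)"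
    using assms unfolding l2_iff by (intro summable_add summable_mult)
  then show ?thesis unfolding l2_iff
    by (rule summable_comparison_test'[where N = 0]) (simp add: norm_add_square_le)
qed

lemma l2_scaleC: "x \<in> l2 \<Longrightarrow> (\<lambda>n. c *\<^sub>C x n) \<in> l2"
  by (simp add: l2_iff norm_scaleC power_mult_distrib summable_mult)

lemma l2_sum: "(\<And>i. i \<in> S \<Longrightarrow> f i \<in> l2) \<Longrightarrow> (\<lambda>n. \<Sum>i\<in>S. f i n) \<in> l2"
proof (induction S rule: infinite_finite_induct)
  case (insert a S)
  then show ?case using l2_add[of "f a" "\<lambda>n. \<Sum>i\<in>S. f i n"] by simp
qed simp_all

lemma l2_bounded_partial_sums:
  assumes "\<And>L. (\<Sum>i<L. (norm (x i))\<^sup>2) \<le> B"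
  shows "x \<in> l2" "(l2norm x)\<^sup>2 \<le> B"
proof -
  show l: "x \<in> l2" unfolding l2_iff by (rule summableI_nonneg_bounded[OF _ assms]) simp
  then show "(l2norm x)\<^sup>2 \<le> B" unfolding l2norm_def l2_iff
    using suminf_le_const[OF _ assms] suminf_nonneg[of "\<lambda>n. (norm (x n))\<^sup>2"] by simp
qed


lemma partial_sum_le_l2norm: "x \<in> l2 \<Longrightarrow> finite A \<Longrightarrow> (\<Sum>i\<in>A. (norm (x i))\<^sup>2) \<le> (l2norm x)\<^sup>2"
  unfolding l2norm_def l2_iff using sum_le_suminf[of "\<lambda>n. (norm (x n))\<^sup>2" A]
    suminf_nonneg[of "\<lambda>n. (norm (x n))\<^sup>2"] by simp

lemma l2norm_nonneg: "x \<in> l2 \<Longrightarrow> 0 \<le> l2norm x"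
  by (simp add: l2norm_def l2_iff suminf_nonneg)

lemma l2norm_zero [simp]: "l2norm (\<lambda>k. 0) = 0"
  by (simp add: l2norm_def)

lemma delta_in_l2: "(\<lambda>k. if k = n then h else 0) \<in> l2"
  unfolding l2_iff by (rule summable_finite[of "{n}"]) auto

lemma l2norm_delta: "l2norm (\<lambda>k. if k = n then h else 0) = norm h"
proof -
  have "(\<lambda>k. (norm (if k = n then h else 0))\<^sup>2) = (\<lambda>k. if k = n then (norm h)\<^sup>2 else 0)" by auto
  then show ?thesis unfolding l2norm_def
    using sums_unique[OF sums_single[of n "\<lambda>_. (norm h)\<^sup>2"]] by simp
qed

section \<open>Quadratic nearness as boundedness of a weighted Hankel matrix\<close>

text \<open>\<open>B\<close> bounds the squared norm. Testing finite sections presupposes no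
  convergence of the rows.\<close>

definition block_bounded :: "(nat \<Rightarrow> nat \<Rightarrow> complex) \<Rightarrow> (nat \<Rightarrow> 'a \<Rightarrow> 'a::complex_inner) \<Rightarrow> real \<Rightarrow> bool" where
  "block_bounded a C B \<longleftrightarrow> (\<forall>L N h.
     (\<Sum>i<L. (norm (\<Sum>j<N. a i j *\<^sub>C C (i + j) (h j)))\<^sup>2) \<le> B * (\<Sum>j<N. (norm (h j))\<^sup>2))"

text \<open>Column \<open>j\<close> arises from the power \<open>n = j + 1\<close> of the operator
  matrix, whose corner carries the factor \<open>n\<close>.\<close>

definition column_weighted :: "(nat \<Rightarrow> complex) \<Rightarrow> nat \<Rightarrow> nat \<Rightarrow> complex" where
  "column_weighted \<alpha> i j = of_nat (Suc j) * \<alpha> (i + j)"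

definition delta0 :: "'a::complex_inner \<Rightarrow> 'a l2sum" where
  "delta0 h = ((\<lambda>k. 0), (\<lambda>k. if k = 0 then h else 0))"

lemma Hsub_eq: "Hsub = range delta0"
  by (auto simp: Hsub_def delta0_def)

lemma delta0_K2: "delta0 h \<in> K2"
  by (simp add: delta0_def K2_def delta_in_l2)

lemma Knorm_delta0: "Knorm (delta0 h) = norm h"
  by (simp add: Knorm_def delta0_def l2norm_delta)

lemma fshift_delta: "fshift (\<lambda>k. if k = n then h else 0) = (\<lambda>k. if k = Suc n then h else 0)"
  by (auto simp: fshift_def fun_eq_iff)

lemma R0_pow: "(R0 ^^ n) (delta0 h) = ((\<lambda>k. 0), (\<lambda>k. if k = n then h else 0))"
  by (induction n) (simp_all add: delta0_def R0_def bshift_def fshift_delta)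

context car_family begin

lemma Hankel_delta:
  "Hankel_op \<alpha> C (\<lambda>k. if k = n then h else 0) = (\<lambda>i. \<alpha> (i + n) *\<^sub>C C (i + n) h)"
proof
  fix i
  have "(\<lambda>j. \<alpha> (i + j) *\<^sub>C C (i + j) (if j = n then h else 0)) =
      (\<lambda>j. if j = n then \<alpha> (i + n) *\<^sub>C C (i + n) h else 0)" by auto
  then show "Hankel_op \<alpha> C (\<lambda>k. if k = n then h else 0) i = \<alpha> (i + n) *\<^sub>C C (i + n) h"
    unfolding Hankel_op_def using sums_unique[OF sums_single[of n "\<lambda>_. \<alpha> (i + n) *\<^sub>C C (i + n) h"]] by simp
qed

text \<open>One more application shifts the previous corner onto the Hankel column that is added,
  because \<Gamma> S = S^* \<Gamma>; so only the multiplicity grows. At \<open>n = 0\<close> the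
  truncated index \<open>i + n - 1\<close> is harmless because the factor \<open>of_nat n\<close>
  vanishes.\<close>

lemma Rop_pow: "(Rop (Hankel_op \<alpha> C) ^^ n) (delta0 h) =
   ((\<lambda>i. (of_nat n * \<alpha> (i + n - 1)) *\<^sub>C C (i + n - 1) h), (\<lambda>k. if k = n then h else 0))"
proof (induction n)
  case (Suc n)
  show ?case
    unfolding funpow.simps comp_apply Suc.IH
    by (simp add: Rop_def bshift_def fshift_delta Hankel_delta distrib_right scaleC_add_left add.commute)
qed (simp add: delta0_def)

lemma column_l2:
  assumes "summable (\<lambda>n. (cmod (\<alpha> n))\<^sup>2)"
  shows "(\<lambda>i. \<alpha> (i + n) *\<^sub>C C (i + n) h) \<in> l2"
  unfolding l2_iff
proof (rule summable_comparison_test'[where N = 0])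
  show "summable (\<lambda>i. (cmod (\<alpha> (i + n)))\<^sup>2 * (norm h)\<^sup>2)"
    using summable_ignore_initial_segment[OF assms, of n] by (rule summable_mult2)
  show "norm ((norm (\<alpha> (i + n) *\<^sub>C C (i + n) h))\<^sup>2) \<le> (cmod (\<alpha> (i + n)))\<^sup>2 * (norm h)\<^sup>2" for i
    by (simp add: norm_scaleC power_mult_distrib mult_left_mono power_mono norm_C_le)
qed

lemma weighted_column_sum_l2:
  assumes "summable (\<lambda>n. (cmod (\<alpha> n))\<^sup>2)"
  shows "(\<lambda>i. \<Sum>j<N. (of_nat (Suc j) * \<alpha> (i + j)) *\<^sub>C C (i + j) (h j)) \<in> l2"
proof (rule l2_sum)
  fix j
  show "(\<lambda>i. (of_nat (Suc j) * \<alpha> (i + j)) *\<^sub>C C (i + j) (h j)) \<in> l2"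
    using l2_scaleC[OF column_l2[OF assms, of j "h j"], of "of_nat (Suc j)"] by (simp only: scaleC_scaleC)
qed

text \<open>The second components cancel and the term \<open>n = 0\<close> vanishes, so the sum runs
  over \<open>n = j + 1\<close>.\<close>

lemma Knorm_difference:
  assumes "summable (\<lambda>n. (cmod (\<alpha> n))\<^sup>2)"
  shows "Knorm (Ksum (\<lambda>n. Kdiff ((Rop (Hankel_op \<alpha> C) ^^ n) (delta0 (h n))) ((R0 ^^ n) (delta0 (h n)))) {..N})
   = l2norm (\<lambda>i. \<Sum>j<N. (of_nat (Suc j) * \<alpha> (i + j)) *\<^sub>C C (i + j) (h (Suc j)))"
  using l2norm_nonneg[OF weighted_column_sum_l2[OF assms, where N = N and h = "\<lambda>j. h (Suc j)"]]
  by (simp add: Rop_pow R0_pow Kdiff_def Ksum_def Knorm_def lessThan_Suc_atMost[symmetric]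
      sum.lessThan_Suc_shift del: sum.lessThan_Suc of_nat_Suc)

lemma quad_near_iff:
  assumes a: "summable (\<lambda>n. (cmod (\<alpha> n))\<^sup>2)"
  shows "quad_near_mod_H (Rop (Hankel_op \<alpha> C)) R0 \<longleftrightarrow> (\<exists>B\<ge>0. block_bounded (column_weighted \<alpha>) C B)"
proof
  assume "quad_near_mod_H (Rop (Hankel_op \<alpha> C)) R0"
  then obtain s where s: "\<forall>N. \<forall>x. (\<forall>n\<le>N. x n \<in> Hsub) \<longrightarrow>
      Knorm (Ksum (\<lambda>n. Kdiff ((Rop (Hankel_op \<alpha> C) ^^ n) (x n)) ((R0 ^^ n) (x n))) {..N})
        \<le> s * sqrt (\<Sum>n\<le>N. (Knorm (x n))\<^sup>2)"
    unfolding quad_near_mod_H_def by (rule exE)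
  have "block_bounded (column_weighted \<alpha>) C (s\<^sup>2)" unfolding block_bounded_def column_weighted_def
  proof (intro allI)
    fix L N and h :: "nat \<Rightarrow> 'a"
    \<comment> \<open>Nearness tests \<open>N + 1\<close> vectors, of which the one at
      \<open>n = 0\<close> contributes nothing to the difference; it is set to zero so that
      \<open>h\<close> fills exactly the columns below \<open>N\<close>.\<close>
    define h' where "h' n = (if n = 0 then 0 else h (n - 1))" for n
    define y where "y i = (\<Sum>j<N. (of_nat (Suc j) * \<alpha> (i + j)) *\<^sub>C C (i + j) (h j))" for i
    have yl: "y \<in> l2" unfolding y_def by (rule weighted_column_sum_l2[OF a])
    have "l2norm y \<le> s * sqrt (\<Sum>n\<le>N. (norm (h' n))\<^sup>2)"
      using s[rule_format, of N "\<lambda>n. delta0 (h' n)"] unfolding Knorm_difference[OF a]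
      by (simp add: Hsub_eq Knorm_delta0 y_def[abs_def] h'_def)
    also have "(\<Sum>n\<le>N. (norm (h' n))\<^sup>2) = (\<Sum>j<N. (norm (h j))\<^sup>2)"
      by (simp add: h'_def lessThan_Suc_atMost[symmetric] sum.lessThan_Suc_shift del: sum.lessThan_Suc)
    finally have "(l2norm y)\<^sup>2 \<le> (s * sqrt (\<Sum>j<N. (norm (h j))\<^sup>2))\<^sup>2"
      using l2norm_nonneg[OF yl] by (rule power_mono)
    also have "\<dots> = s\<^sup>2 * (\<Sum>j<N. (norm (h j))\<^sup>2)"
      by (simp add: power_mult_distrib sum_nonneg)
    finally show "(\<Sum>i<L. (norm (\<Sum>j<N. (of_nat (Suc j) * \<alpha> (i + j)) *\<^sub>C C (i + j) (h j)))\<^sup>2)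
       \<le> s\<^sup>2 * (\<Sum>j<N. (norm (h j))\<^sup>2)"
      using partial_sum_le_l2norm[OF yl, of "{..<L}"] by (simp add: y_def)
  qed
  then show "\<exists>B\<ge>0. block_bounded (column_weighted \<alpha>) C B" by (intro exI[of _ "s\<^sup>2"]) simp
next
  assume "\<exists>B\<ge>0. block_bounded (column_weighted \<alpha>) C B"
  then obtain B where B0: "B \<ge> 0" and B: "block_bounded (column_weighted \<alpha>) C B" by blast
  show "quad_near_mod_H (Rop (Hankel_op \<alpha> C)) R0"
    unfolding quad_near_mod_H_def
  proof (intro exI[of _ "sqrt B"] allI impI)
    fix N and x :: "nat \<Rightarrow> 'a l2sum"
    assume "\<forall>n\<le>N. x n \<in> Hsub"
    then have "\<forall>n. \<exists>h. n \<le> N \<longrightarrow> x n = delta0 h" by (auto simp: Hsub_eq)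
    then obtain h where h: "\<And>n. n \<le> N \<Longrightarrow> x n = delta0 (h n)" by metis
    define y where "y i = (\<Sum>j<N. (of_nat (Suc j) * \<alpha> (i + j)) *\<^sub>C C (i + j) (h (Suc j)))" for i
    have "Ksum (\<lambda>n. Kdiff ((Rop (Hankel_op \<alpha> C) ^^ n) (x n)) ((R0 ^^ n) (x n))) {..N} =
       Ksum (\<lambda>n. Kdiff ((Rop (Hankel_op \<alpha> C) ^^ n) (delta0 (h n))) ((R0 ^^ n) (delta0 (h n)))) {..N}"
      unfolding Ksum_def by (simp add: h)
    then have "Knorm (Ksum (\<lambda>n. Kdiff ((Rop (Hankel_op \<alpha> C) ^^ n) (x n)) ((R0 ^^ n) (x n))) {..N}) = l2norm y"
      unfolding y_def[abs_def] by (simp only: Knorm_difference[OF a])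
    also have "\<dots> \<le> sqrt (B * (\<Sum>j<N. (norm (h (Suc j)))\<^sup>2))"
    proof (rule real_le_rsqrt, rule l2_bounded_partial_sums(2))
      fix L
      show "(\<Sum>i<L. (norm (y i))\<^sup>2) \<le> B * (\<Sum>j<N. (norm (h (Suc j)))\<^sup>2)"
        using B[unfolded block_bounded_def column_weighted_def, rule_format, where L = L and N = N and h = "\<lambda>j. h (Suc j)"] by (simp only: y_def)
    qed
    also have "\<dots> \<le> sqrt (B * (\<Sum>n\<le>N. (norm (h n))\<^sup>2))"
      using B0 by (intro real_sqrt_le_mono mult_left_mono)
        (auto simp: lessThan_Suc_atMost[symmetric] sum.lessThan_Suc_shift simp del: sum.lessThan_Suc)
    also have "(\<Sum>n\<le>N. (norm (h n))\<^sup>2) = (\<Sum>n\<le>N. (Knorm (x n))\<^sup>2)"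
      by (simp add: h Knorm_delta0)
    finally show "Knorm (Ksum (\<lambda>n. Kdiff ((Rop (Hankel_op \<alpha> C) ^^ n) (x n)) ((R0 ^^ n) (x n))) {..N})
        \<le> sqrt B * sqrt (\<Sum>n\<le>N. (Knorm (x n))\<^sup>2)"
      by (simp add: real_sqrt_mult)
  qed
qed

end

section \<open>Shears of \<open>l2 \<times> l2\<close>\<close>

text \<open>Rows are given by \<open>suminf\<close>, which is meaningless on divergent series, so
  linearity is demanded on \<open>l2\<close> only.\<close>

definition bounded_l2_op :: "real \<Rightarrow> ((nat \<Rightarrow> 'a::complex_inner) \<Rightarrow> nat \<Rightarrow> 'a) \<Rightarrow> bool" where
  "bounded_l2_op B X \<longleftrightarrow> (\<forall>g\<in>l2. X g \<in> l2 \<and> (l2norm (X g))\<^sup>2 \<le> B * (l2norm g)\<^sup>2) \<and>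
     (\<forall>g\<in>l2. \<forall>h\<in>l2. X (\<lambda>k. g k + h k) = (\<lambda>k. X g k + X h k)) \<and>
     (\<forall>c. \<forall>g\<in>l2. X (\<lambda>k. c *\<^sub>C g k) = (\<lambda>k. c *\<^sub>C X g k))"

text \<open>The upper triangular operator matrix with identities on the diagonal and corner
  \<open>X\<close>.\<close>

definition shear :: "((nat \<Rightarrow> 'a::complex_inner) \<Rightarrow> nat \<Rightarrow> 'a) \<Rightarrow> 'a l2sum \<Rightarrow> 'a l2sum" where
  "shear X z = ((\<lambda>k. fst z k + X (snd z) k), snd z)"

lemma l2norm_square: "x \<in> l2 \<Longrightarrow> (l2norm x)\<^sup>2 = (\<Sum>n. (norm (x n))\<^sup>2)"
  by (simp add: l2norm_def l2_iff suminf_nonneg)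

lemma l2norm_add_square:
  assumes x: "x \<in> l2" and y: "y \<in> l2"
  shows "(l2norm (\<lambda>n. x n + y n))\<^sup>2 \<le> 2 * (l2norm x)\<^sup>2 + 2 * (l2norm y)\<^sup>2"
proof (rule l2_bounded_partial_sums(2))
  fix L
  have "(\<Sum>i<L. (norm (x i + y i))\<^sup>2) \<le> (\<Sum>i<L. 2 * (norm (x i))\<^sup>2 + 2 * (norm (y i))\<^sup>2)"
    by (intro sum_mono norm_add_square_le)
  also have "\<dots> = 2 * (\<Sum>i<L. (norm (x i))\<^sup>2) + 2 * (\<Sum>i<L. (norm (y i))\<^sup>2)"
    by (simp add: sum.distrib sum_distrib_left)
  also have "\<dots> \<le> 2 * (l2norm x)\<^sup>2 + 2 * (l2norm y)\<^sup>2"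
    using partial_sum_le_l2norm[OF x, of "{..<L}"] partial_sum_le_l2norm[OF y, of "{..<L}"] by simp
  finally show "(\<Sum>i<L. (norm (x i + y i))\<^sup>2) \<le> 2 * (l2norm x)\<^sup>2 + 2 * (l2norm y)\<^sup>2" .
qed

lemma K2_iff: "z \<in> K2 \<longleftrightarrow> fst z \<in> l2 \<and> snd z \<in> l2"
  by (cases z) (simp add: K2_def)

lemma Kadd_K2: "z \<in> K2 \<Longrightarrow> w \<in> K2 \<Longrightarrow> Kadd z w \<in> K2"
  by (simp add: K2_iff Kadd_def l2_add)

lemma Kscale_K2: "z \<in> K2 \<Longrightarrow> Kscale c z \<in> K2"
  by (simp add: K2_iff Kscale_def l2_scaleC)

lemma Knorm_nonneg: "0 \<le> Knorm z"
  by (simp add: Knorm_def)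

lemma Knorm_square: "(Knorm z)\<^sup>2 = (l2norm (fst z))\<^sup>2 + (l2norm (snd z))\<^sup>2"
  by (simp add: Knorm_def)

lemma shear_K2: "bounded_l2_op B X \<Longrightarrow> z \<in> K2 \<Longrightarrow> shear X z \<in> K2"
  by (simp add: K2_iff shear_def bounded_l2_op_def l2_add)

lemma bounded_K_op_shear:
  assumes X: "bounded_l2_op B X"
  shows "bounded_K_op (shear X)"
  unfolding bounded_K_op_def
proof (intro conjI ballI allI)
  show "shear X ` K2 \<subseteq> K2" using shear_K2[OF X] by blast
next
  fix z w :: "'a l2sum" assume "z \<in> K2" "w \<in> K2"
  then show "shear X (Kadd z w) = Kadd (shear X z) (shear X w)"
    using X by (simp add: shear_def Kadd_def K2_iff bounded_l2_op_def algebra_simps)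
next
  fix c and z :: "'a l2sum" assume "z \<in> K2"
  then show "shear X (Kscale c z) = Kscale c (shear X z)"
    using X by (simp add: shear_def Kscale_def K2_iff bounded_l2_op_def scaleC_add_right)
next
  show "\<exists>M. \<forall>z\<in>K2. Knorm (shear X z) \<le> M * Knorm z"
  proof (intro exI[of _ "sqrt (2 * \<bar>B\<bar> + 2)"] ballI)
    fix z :: "'a l2sum" assume z: "z \<in> K2"
    have "(l2norm (X (snd z)))\<^sup>2 \<le> B * (l2norm (snd z))\<^sup>2"
      using X z by (simp add: bounded_l2_op_def K2_iff)
    also have "\<dots> \<le> \<bar>B\<bar> * (l2norm (snd z))\<^sup>2" by (intro mult_right_mono) auto
    finally have XB: "(l2norm (X (snd z)))\<^sup>2 \<le> \<bar>B\<bar> * (l2norm (snd z))\<^sup>2" .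
    have "(Knorm (shear X z))\<^sup>2 \<le> 2 * (l2norm (fst z))\<^sup>2 + 2 * (l2norm (X (snd z)))\<^sup>2 + (l2norm (snd z))\<^sup>2"
      unfolding Knorm_square shear_def using l2norm_add_square[of "fst z" "X (snd z)"] X z
      by (simp add: K2_iff bounded_l2_op_def)
    also have "\<dots> \<le> (2 * \<bar>B\<bar> + 2) * (Knorm z)\<^sup>2"
    proof -
      have "(2 * \<bar>B\<bar> + 2) * (Knorm z)\<^sup>2 = 2 * (\<bar>B\<bar> * (l2norm (fst z))\<^sup>2) + 2 * (\<bar>B\<bar> * (l2norm (snd z))\<^sup>2)
          + 2 * (l2norm (fst z))\<^sup>2 + 2 * (l2norm (snd z))\<^sup>2"
        unfolding Knorm_square by (simp add: algebra_simps)
      moreover have "0 \<le> \<bar>B\<bar> * (l2norm (fst z))\<^sup>2" "0 \<le> (l2norm (snd z))\<^sup>2" by simp_all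
      ultimately show ?thesis using XB by linarith
    qed
    finally have "(Knorm (shear X z))\<^sup>2 \<le> (sqrt (2 * \<bar>B\<bar> + 2) * Knorm z)\<^sup>2"
      by (simp add: power_mult_distrib)
    then show "Knorm (shear X z) \<le> sqrt (2 * \<bar>B\<bar> + 2) * Knorm z"
      by (rule power2_le_imp_le) (simp add: Knorm_nonneg)
  qed
qed

text \<open>This transfers boundedness to \<open>inv_into K2\<close>, whose values are known on
  \<open>K2\<close> only.\<close>

lemma bounded_K_op_cong:
  assumes T: "bounded_K_op T" and eq: "\<And>z. z \<in> K2 \<Longrightarrow> U z = T z"
  shows "bounded_K_op U"
  using T unfolding bounded_K_op_def
  by (auto simp: eq Kadd_K2 Kscale_K2 image_subset_iff)

text \<open>The inverse is the shear by the negative of \<open>X\<close>.\<close>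

lemma shear_invertible:
  assumes X: "bounded_l2_op B X"
  shows "invertible_K_op (shear X)" "inj_on (shear X) K2"
proof -
  define Y where "Y g = (\<lambda>k. - X g k)" for g
  have "l2norm (\<lambda>k. - X g k) = l2norm (X g)" for g by (simp add: l2norm_def)
  moreover have "- (c *\<^sub>C x) = c *\<^sub>C (- x)" for c and x :: 'a
    by (simp add: scaleC_minus1[symmetric] scaleC_scaleC)
  ultimately have Y: "bounded_l2_op B Y"
    using X by (auto simp: bounded_l2_op_def Y_def l2_iff)
  have XY: "shear X (shear Y z) = z" and YX: "shear Y (shear X z) = z" for z
    by (auto simp: shear_def Y_def)
  show inj: "inj_on (shear X) K2" by (rule inj_on_inverseI[of _ "shear Y"]) (rule YX)
  have im: "shear X ` K2 = K2"
  proof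
    show "shear X ` K2 \<subseteq> K2" using shear_K2[OF X] by blast
    show "K2 \<subseteq> shear X ` K2"
    proof
      fix z :: "'a l2sum" assume "z \<in> K2"
      then show "z \<in> shear X ` K2" by (intro image_eqI[of _ _ "shear Y z"] shear_K2[OF Y]) (simp_all add: XY)
    qed
  qed
  have "inv_into K2 (shear X) z = shear Y z" if "z \<in> K2" for z
    using inv_into_f_f[OF inj shear_K2[OF Y that]] by (simp add: XY)
  then have "bounded_K_op (inv_into K2 (shear X))"
    by (rule bounded_K_op_cong[OF bounded_K_op_shear[OF Y]])
  then show "invertible_K_op (shear X)"
    using bounded_K_op_shear[OF X] inj im by (simp add: invertible_K_op_def bij_betw_def)
qed

section \<open>The shifts and the contraction \<open>R0\<close>\<close>

lemma bshift_l2: "x \<in> l2 \<Longrightarrow> bshift x \<in> l2"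
  by (simp add: l2_iff bshift_def summable_Suc_iff[of "\<lambda>n. (norm (x n))\<^sup>2"])

lemma l2norm_bshift: "x \<in> l2 \<Longrightarrow> (l2norm (bshift x))\<^sup>2 \<le> (l2norm x)\<^sup>2"
  using suminf_split_head[of "\<lambda>n. (norm (x n))\<^sup>2"]
  by (simp add: l2norm_square bshift_l2) (simp add: bshift_def l2_iff)

lemma fshift_l2: "x \<in> l2 \<Longrightarrow> fshift x \<in> l2"
  using summable_Suc_iff[of "\<lambda>n. (norm (fshift x n))\<^sup>2"] by (simp add: l2_iff fshift_def)

lemma l2norm_fshift: "x \<in> l2 \<Longrightarrow> (l2norm (fshift x))\<^sup>2 = (l2norm x)\<^sup>2"
  using suminf_split_head[of "\<lambda>n. (norm (fshift x n))\<^sup>2"] fshift_l2[of x]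
  by (simp add: l2norm_square) (simp add: fshift_def l2_iff)

lemma R0_K2: "z \<in> K2 \<Longrightarrow> R0 z \<in> K2"
  by (simp add: K2_iff R0_def bshift_l2 fshift_l2)

lemma Knorm_R0: "z \<in> K2 \<Longrightarrow> Knorm (R0 z) \<le> Knorm z"
  unfolding Knorm_def by (intro real_sqrt_le_mono) (simp add: K2_iff R0_def l2norm_bshift l2norm_fshift)

section \<open>Boundedness implies similarity\<close>

lemma bounded_linear_scaleC: "bounded_linear (\<lambda>x::'a::complex_inner. c *\<^sub>C x)"
  by (rule bounded_linear_intro[where K = "cmod c"])
    (auto simp: scaleC_add_right scaleR_scaleC scaleC_scaleC norm_scaleC mult.commute)

locale car_hilbert = car_family C D
  for C D :: "nat \<Rightarrow> 'a::{complex_inner, complete_space} \<Rightarrow> 'a"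
begin

definition block_op :: "(nat \<Rightarrow> nat \<Rightarrow> complex) \<Rightarrow> (nat \<Rightarrow> 'a) \<Rightarrow> nat \<Rightarrow> 'a" where
  "block_op a g i = (\<Sum>j. a i j *\<^sub>C C (i + j) (g j))"

text \<open>Replacing \<open>g\<close> by zero before \<open>m\<close> turns a segment of row
  \<open>i\<close> into a full row of a finite section; keeping only that row of the section bound
  yields the Cauchy estimate.\<close>

lemma block_op_summable:
  assumes B0: "B \<ge> 0" and B: "block_bounded a C B" and g: "g \<in> l2"
  shows "summable (\<lambda>j. a i j *\<^sub>C C (i + j) (g j))" (is "summable ?f")
proof (rule summable_of_square_bound[OF _ g[unfolded l2_iff] B0])
  fix m n
  define h where "h j = (if m \<le> j then g j else 0)" for j
  define y where "y i = (\<Sum>j<n. a i j *\<^sub>C C (i + j) (h j))" for i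
  have "sum ?f {m..<n} = y i"
    unfolding y_def by (rule sum.mono_neutral_cong_left) (auto simp: h_def)
  then have "(norm (sum ?f {m..<n}))\<^sup>2 = (norm (y i))\<^sup>2" by simp
  also have "\<dots> \<le> (\<Sum>i<Suc i. (norm (y i))\<^sup>2)"
    by (rule member_le_sum) auto
  also have "\<dots> \<le> B * (\<Sum>j<n. (norm (h j))\<^sup>2)"
    using B unfolding y_def block_bounded_def by (elim allE)
  also have "(\<Sum>j<n. (norm (h j))\<^sup>2) = (\<Sum>j\<in>{m..<n}. (norm (g j))\<^sup>2)"
    by (rule sum.mono_neutral_cong_right) (auto simp: h_def)
  finally show "(norm (sum ?f {m..<n}))\<^sup>2 \<le> B * (\<Sum>j\<in>{m..<n}. (norm (g j))\<^sup>2)" .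
qed simp

text \<open>The section bounds pass to the limit first in the number of columns, with finitely many
  rows fixed, and then in the number of rows.\<close>

lemma bounded_l2_op_block_op:
  assumes B0: "B \<ge> 0" and B: "block_bounded a C B"
  shows "bounded_l2_op B (block_op a)"
proof -
  note summ = block_op_summable[OF B0 B]
  have "(\<Sum>i<L. (norm (block_op a g i))\<^sup>2) \<le> B * (l2norm g)\<^sup>2" if g: "g \<in> l2" for g L
  proof (rule LIMSEQ_le_const2)
    show "(\<lambda>N. \<Sum>i<L. (norm (\<Sum>j<N. a i j *\<^sub>C C (i + j) (g j)))\<^sup>2)
        \<longlonglongrightarrow> (\<Sum>i<L. (norm (block_op a g i))\<^sup>2)"
      unfolding block_op_def
      by (intro tendsto_sum tendsto_power tendsto_norm summable_LIMSEQ summ g)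
    have "(\<Sum>i<L. (norm (\<Sum>j<N. a i j *\<^sub>C C (i + j) (g j)))\<^sup>2) \<le> B * (\<Sum>j<N. (norm (g j))\<^sup>2)" for N
      using B by (simp only: block_bounded_def)
    also have "B * (\<Sum>j<N. (norm (g j))\<^sup>2) \<le> B * (l2norm g)\<^sup>2" for N
      using B0 partial_sum_le_l2norm[OF g] by (intro mult_left_mono) auto
    finally show "\<exists>N. \<forall>n\<ge>N. (\<Sum>i<L. (norm (\<Sum>j<n. a i j *\<^sub>C C (i + j) (g j)))\<^sup>2)
        \<le> B * (l2norm g)\<^sup>2" by blast
  qed
  note bnd = l2_bounded_partial_sums[OF this]
  have add: "block_op a (\<lambda>k. g k + h k) = (\<lambda>k. block_op a g k + block_op a h k)"
    if "g \<in> l2" "h \<in> l2" for g h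
    unfolding block_op_def C_add scaleC_add_right
    by (rule ext, rule suminf_add[symmetric]) (intro summ that)+
  have scale: "block_op a (\<lambda>k. c *\<^sub>C g k) = (\<lambda>k. c *\<^sub>C block_op a g k)"
    if "g \<in> l2" for g c
    unfolding block_op_def C_scaleC
      bounded_linear.suminf[OF bounded_linear_scaleC summ[OF that]]
    by (simp add: scaleC_scaleC mult_ac)
  show ?thesis unfolding bounded_l2_op_def using bnd add scale by blast
qed

lemma Hankel_op_eq_block_op: "Hankel_op \<alpha> C = block_op (\<lambda>i j. \<alpha> (i + j))"
  by (simp add: fun_eq_iff Hankel_op_def block_op_def)

lemma bounded_l2_op_Hankel:
  assumes "summable (\<lambda>n. (cmod (\<alpha> n))\<^sup>2)"
  shows "bounded_l2_op (\<Sum>n. (cmod (\<alpha> n))\<^sup>2) (Hankel_op \<alpha> C)"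
  unfolding Hankel_op_eq_block_op
proof (rule bounded_l2_op_block_op)
  show "0 \<le> (\<Sum>n. (cmod (\<alpha> n))\<^sup>2)" using assms by (simp add: suminf_nonneg)
  show "block_bounded (\<lambda>i j. \<alpha> (i + j)) C (\<Sum>n. (cmod (\<alpha> n))\<^sup>2)"
    unfolding block_bounded_def
  proof (intro allI)
    fix L N and h :: "nat \<Rightarrow> 'a"
    have "(\<Sum>i<L. (norm (\<Sum>j<N. \<alpha> (i + j) *\<^sub>C C (i + j) (h j)))\<^sup>2)
        \<le> (\<Sum>k<L+N. (cmod (\<alpha> k))\<^sup>2) * (\<Sum>j<N. (norm (h j))\<^sup>2)"
      by (rule Hankel_bound)
    also have "\<dots> \<le> (\<Sum>n. (cmod (\<alpha> n))\<^sup>2) * (\<Sum>j<N. (norm (h j))\<^sup>2)"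
      using assms by (intro mult_right_mono sum_le_suminf sum_nonneg) auto
    finally show "(\<Sum>i<L. (norm (\<Sum>j<N. \<alpha> (i + j) *\<^sub>C C (i + j) (h j)))\<^sup>2)
        \<le> (\<Sum>n. (cmod (\<alpha> n))\<^sup>2) * (\<Sum>j<N. (norm (h j))\<^sup>2)" .
  qed
qed

text \<open>The matrix \<open>X\<^sub>i\<^sub>j = j \<alpha>\<^sub>i\<^sub>+\<^sub>j\<^sub>-\<^sub>1 C\<^sub>i\<^sub>+\<^sub>j\<^sub>-\<^sub>1\<close>, that is \<open>block_op (column_weighted \<alpha>) \<circ> bshift\<close>, solves
  the commutator equation \<open>X S - S\<^sup>* X = \<Gamma>\<close>.\<close>

lemma commutator_equation:
  assumes B0: "B \<ge> 0" and B: "block_bounded (column_weighted \<alpha>) C B" and g: "g \<in> l2"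
  shows "block_op (column_weighted \<alpha>) (bshift g) (Suc i) + Hankel_op \<alpha> C g i = block_op (column_weighted \<alpha>) g i"
proof -
  \<comment> \<open>Shifted by one, \<open>v\<close> is row \<open>Suc i\<close> of the weighted
    matrix applied to \<open>bshift g\<close>; its extra term at \<open>j = 0\<close> vanishes.
    Since the weights of \<open>w\<close> and \<open>v\<close> differ by 1, \<open>w j - v j\<close>
    is the Hankel term.\<close>
  define v where "v j = (of_nat j * \<alpha> (i + j)) *\<^sub>C C (i + j) (g j)" for j
  define w where "w j = (of_nat (Suc j) * \<alpha> (i + j)) *\<^sub>C C (i + j) (g j)" for j
  have w: "summable w" unfolding w_def by (rule block_op_summable[OF B0 B g, unfolded column_weighted_def])
  have v': "(\<lambda>j. v (Suc j)) = (\<lambda>j. (of_nat (Suc j) * \<alpha> (Suc i + j)) *\<^sub>C C (Suc i + j) (bshift g j))"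
    by (simp add: v_def bshift_def)
  then have vs: "summable (\<lambda>j. v (Suc j))"
    using block_op_summable[OF B0 B bshift_l2[OF g], of "Suc i"] by (simp add: column_weighted_def)
  then have v: "summable v" by (subst (asm) summable_Suc_iff)
  have "block_op (column_weighted \<alpha>) (bshift g) (Suc i) = (\<Sum>j. v (Suc j))"
    unfolding block_op_def column_weighted_def v' ..
  also have "\<dots> = suminf v" using suminf_split_head[OF v] by (simp add: v_def)
  finally have 1: "block_op (column_weighted \<alpha>) (bshift g) (Suc i) = suminf v" .
  have "\<alpha> (i + j) *\<^sub>C C (i + j) (g j) = w j - v j" for j
    by (simp add: v_def w_def distrib_right scaleC_add_left)
  then have "Hankel_op \<alpha> C g i = suminf w - suminf v"
    unfolding Hankel_op_def by (simp add: suminf_diff[OF w v])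
  then show ?thesis using 1 by (simp add: block_op_def column_weighted_def w_def[abs_def])
qed

lemma similar_if_bounded:
  assumes B0: "B \<ge> 0" and B: "block_bounded (column_weighted \<alpha>) C B"
  shows "similar_to_contraction (Rop (Hankel_op \<alpha> C))"
proof -
  define X where "X g = block_op (column_weighted \<alpha>) (bshift g)" for g
  have bs: "(l2norm (block_op (column_weighted \<alpha>) (bshift g)))\<^sup>2 \<le> B * (l2norm g)\<^sup>2" if "g \<in> l2" for g
  proof -
    have "(l2norm (block_op (column_weighted \<alpha>) (bshift g)))\<^sup>2 \<le> B * (l2norm (bshift g))\<^sup>2"
      using bounded_l2_op_block_op[OF B0 B] bshift_l2[OF that] by (simp add: bounded_l2_op_def)
    also have "\<dots> \<le> B * (l2norm g)\<^sup>2" using l2norm_bshift[OF that] B0 by (rule mult_left_mono)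
    finally show ?thesis .
  qed
  have X: "bounded_l2_op B X"
    using bounded_l2_op_block_op[OF B0 B] bs bshift_l2 unfolding bounded_l2_op_def X_def
    by (auto simp: bshift_def)
  \<comment> \<open>Comparing the upper right corners, this is S^* X + \<Gamma> = X S, the
    commutator equation. It makes the conjugated operator equal to the contraction
    \<open>R0\<close>.\<close>
  have R: "Rop (Hankel_op \<alpha> C) (shear X z) = shear X (R0 z)" if "z \<in> K2" for z
  proof -
    have fb: "bshift (fshift (snd z)) = snd z" by (simp add: bshift_def fshift_def)
    have "snd z \<in> l2" using that by (simp add: K2_iff)
    from commutator_equation[OF B0 B this]
    have "bshift (\<lambda>k. fst z k + X (snd z) k) k + Hankel_op \<alpha> C (snd z) k =
        bshift (fst z) k + X (fshift (snd z)) k" for k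
      unfolding X_def fb by (simp add: bshift_def add.assoc)
    then show ?thesis by (simp add: Rop_def R0_def shear_def)
  qed
  show ?thesis unfolding similar_to_contraction_def
  proof (intro exI[of _ "shear X"] conjI ballI)
    show "invertible_K_op (shear X)" by (rule shear_invertible[OF X])
    fix z :: "'a l2sum" assume z: "z \<in> K2"
    then show "Knorm (inv_into K2 (shear X) (Rop (Hankel_op \<alpha> C) (shear X z))) \<le> Knorm z"
      by (simp add: R inv_into_f_f[OF shear_invertible(2)[OF X] R0_K2] Knorm_R0)
  qed
qed

end

section \<open>A von Neumann inequality with anticommuting coefficients\<close>

text \<open>The Jordan-Wigner sign. The annihilation matrix of index \<open>k\<close> on functions
  of finite sets has the entry \<open>fermion_sign k J\<close> leading from
  \<open>insert k J\<close> to \<open>J\<close>, for \<open>k\<close> outside \<open>J\<close>.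
  Counting the elements above \<open>k\<close> matches the order of the creation operators in
  \<open>fock\<close>.\<close>

definition fermion_sign :: "nat \<Rightarrow> nat set \<Rightarrow> complex" where
  "fermion_sign k J = (-1) ^ card {l \<in> J. k < l}"

lemma fermion_sign_sq: "fermion_sign k J * fermion_sign k J = 1"
  by (simp add: fermion_sign_def power_mult_distrib[symmetric])

lemma cnj_fermion_sign: "cnj (fermion_sign k J) = fermion_sign k J"
  by (simp add: fermion_sign_def)

lemma fermion_sign_insert_same: "fermion_sign k (insert k J) = fermion_sign k J"
proof -
  have "{l \<in> insert k J. k < l} = {l \<in> J. k < l}" by auto
  then show ?thesis by (simp add: fermion_sign_def)
qed

lemma fermion_sign_insert:
  assumes "finite J" "l \<notin> J"
  shows "fermion_sign k (insert l J) = (if k < l then - fermion_sign k J else fermion_sign k J)"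
proof -
  have "{i \<in> insert l J. k < i} = (if k < l then insert l {i \<in> J. k < i} else {i \<in> J. k < i})" by auto
  then show ?thesis using assms by (simp add: fermion_sign_def)
qed

text \<open>The mixed anticommutation relation of the annihilation matrices and their adjoints,
  paired with an arbitrary \<open>F\<close>. For \<open>k = l\<close> the two sums split the subsets
  by whether they contain \<open>k\<close>; otherwise removing \<open>k\<close> and \<open>l\<close>
  matches the sums term by term with opposite signs.\<close>

lemma sign_anticommute:
  fixes F :: "nat set \<Rightarrow> nat set \<Rightarrow> complex"
  assumes k: "k < d" and l: "l < d"
  shows "(\<Sum>J | J \<subseteq> {..<d} \<and> k \<notin> J \<and> l \<notin> J. fermion_sign k J * fermion_sign l J * F (insert k J) (insert l J)) +
    (\<Sum>J | J \<subseteq> {..<d} \<and> k \<in> J \<and> l \<in> J. fermion_sign l J * fermion_sign k J * F (J - {l}) (J - {k})) =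
    (if k = l then (\<Sum>J | J \<subseteq> {..<d}. F J J) else 0)"
proof (cases "k = l")
  case True
  have "(\<Sum>J | J \<subseteq> {..<d} \<and> k \<notin> J. F (insert k J) (insert k J)) = (\<Sum>J | J \<subseteq> {..<d} \<and> k \<in> J. F J J)"
    by (rule sum.reindex_bij_witness[of _ "\<lambda>J. J - {k}" "insert k"]) (use k in auto)
  moreover have "(\<Sum>J | J \<subseteq> {..<d} \<and> k \<in> J. F (J - {k}) (J - {k})) = (\<Sum>J | J \<subseteq> {..<d} \<and> k \<notin> J. F J J)"
    by (rule sum.reindex_bij_witness[of _ "insert k" "\<lambda>J. J - {k}"]) (use k in \<open>auto simp: insert_absorb\<close>)
  moreover have "(\<Sum>J | J \<subseteq> {..<d}. F J J) = (\<Sum>J | J \<subseteq> {..<d} \<and> k \<in> J. F J J) + (\<Sum>J | J \<subseteq> {..<d} \<and> k \<notin> J. F J J)"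
    by (subst sum.union_disjoint[symmetric]) (auto intro: sum.cong)
  ultimately show ?thesis using True by (simp add: fermion_sign_sq)
next
  case False
  have "(\<Sum>J | J \<subseteq> {..<d} \<and> k \<in> J \<and> l \<in> J. fermion_sign l J * fermion_sign k J * F (J - {l}) (J - {k})) =
    (\<Sum>J | J \<subseteq> {..<d} \<and> k \<notin> J \<and> l \<notin> J. - (fermion_sign k J * fermion_sign l J * F (insert k J) (insert l J)))"
  proof (rule sum.reindex_bij_witness[of _ "\<lambda>J. insert k (insert l J)" "\<lambda>J. J - {k, l}"])
    fix J assume J: "J \<in> {J. J \<subseteq> {..<d} \<and> k \<in> J \<and> l \<in> J}"
    define J' where "J' = J - {k, l}"
    have J': "J = insert k (insert l J')" "finite J'" "k \<notin> J'" "l \<notin> J'"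
      using J finite_subset[of J "{..<d}"] by (auto simp: J'_def)
    have "fermion_sign k J = (if k < l then - fermion_sign k J' else fermion_sign k J')"
      unfolding J'(1) fermion_sign_insert_same by (rule fermion_sign_insert[OF J'(2,4)])
    moreover have "fermion_sign l J = (if l < k then - fermion_sign l J' else fermion_sign l J')"
      unfolding J'(1) insert_commute[of k l J'] fermion_sign_insert_same by (rule fermion_sign_insert[OF J'(2,3)])
    \<comment> \<open>Exactly one of \<open>k < l\<close> and \<open>l < k\<close> holds, so exactly
      one of the two signs flips.\<close>
    ultimately have "fermion_sign l J * fermion_sign k J = - (fermion_sign k J' * fermion_sign l J')"
      using False by (auto simp: mult.commute)
    moreover have "insert k J' = J - {l}" "insert l J' = J - {k}"
      using J' False by auto
    ultimately show "- (fermion_sign k (J - {k, l}) * fermion_sign l (J - {k, l}) * F (insert k (J - {k, l})) (insert l (J - {k, l}))) =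
         fermion_sign l J * fermion_sign k J * F (J - {l}) (J - {k})"
      unfolding J'_def[symmetric] by simp
  qed (use k l in auto)
  then show ?thesis using False by (simp add: sum_negf)
qed

section \<open>The inner product on \<open>K2\<close>\<close>

definition Kinner :: "'a::complex_inner l2sum \<Rightarrow> 'a l2sum \<Rightarrow> complex" where
  "Kinner z w = (\<Sum>n. cinner (fst z n) (fst w n)) + (\<Sum>n. cinner (snd z n) (snd w n))"

definition K0 :: "'a::complex_inner l2sum" where
  "K0 = ((\<lambda>k. 0), (\<lambda>k. 0))"

lemma K0_K2 [simp]: "K0 \<in> K2"
  by (simp add: K0_def K2_iff)

lemma cinner_summable:
  assumes "x \<in> l2" "y \<in> l2" shows "summable (\<lambda>n. cinner (x n) (y n))"
proof (rule summable_comparison_test'[where N = 0])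
  show "summable (\<lambda>n. (norm (x n))\<^sup>2 + (norm (y n))\<^sup>2)"
    using assms unfolding l2_iff by (rule summable_add)
  show "norm (cinner (x n) (y n)) \<le> (norm (x n))\<^sup>2 + (norm (y n))\<^sup>2" for n
  proof -
    have "norm (cinner (x n) (y n)) \<le> norm (x n) * norm (y n)" by (rule cinner_CS)
    also have "\<dots> \<le> (norm (x n))\<^sup>2 + (norm (y n))\<^sup>2"
      using sum_squares_bound[of "norm (x n)" "norm (y n)"] mult_nonneg_nonneg[OF norm_ge_zero norm_ge_zero, of "x n" "y n"]
      by linarith
    finally show ?thesis .
  qed
qed

lemma Kinner_add_left:
  assumes "z \<in> K2" "z' \<in> K2" "w \<in> K2"
  shows "Kinner (Kadd z z') w = Kinner z w + Kinner z' w"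
proof -
  have "(\<Sum>n. cinner (fst z n) (fst w n) + cinner (fst z' n) (fst w n)) =
      (\<Sum>n. cinner (fst z n) (fst w n)) + (\<Sum>n. cinner (fst z' n) (fst w n))"
    using assms by (intro suminf_add[symmetric] cinner_summable) (auto simp: K2_iff)
  moreover have "(\<Sum>n. cinner (snd z n) (snd w n) + cinner (snd z' n) (snd w n)) =
      (\<Sum>n. cinner (snd z n) (snd w n)) + (\<Sum>n. cinner (snd z' n) (snd w n))"
    using assms by (intro suminf_add[symmetric] cinner_summable) (auto simp: K2_iff)
  ultimately show ?thesis by (simp add: Kinner_def Kadd_def cinner_add_left)
qed

lemma Kinner_scale_left:
  assumes "z \<in> K2" "w \<in> K2"
  shows "Kinner (Kscale c z) w = c * Kinner z w"
proof -
  have "(\<Sum>n. c * cinner (fst z n) (fst w n)) = c * (\<Sum>n. cinner (fst z n) (fst w n))"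
    "(\<Sum>n. c * cinner (snd z n) (snd w n)) = c * (\<Sum>n. cinner (snd z n) (snd w n))"
    using assms by (intro suminf_mult cinner_summable; simp add: K2_iff)+
  then show ?thesis by (simp add: Kinner_def Kscale_def cinner_scaleC_left distrib_left)
qed

lemma Kinner_commute:
  assumes "z \<in> K2" "w \<in> K2"
  shows "Kinner z w = cnj (Kinner w z)"
proof -
  have *: "(\<Sum>n. cinner (x n) (y n)) = cnj (\<Sum>n. cinner (y n) (x n))"
    if "x \<in> l2" "y \<in> l2" for x y :: "nat \<Rightarrow> 'a"
    unfolding bounded_linear.suminf[OF bounded_linear_cnj cinner_summable[OF that(2,1)]]
      cinner_commute[symmetric] ..
  have "fst z \<in> l2" "fst w \<in> l2" "snd z \<in> l2" "snd w \<in> l2" using assms by (simp_all add: K2_iff)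
  then have "(\<Sum>n. cinner (fst z n) (fst w n)) = cnj (\<Sum>n. cinner (fst w n) (fst z n))"
    "(\<Sum>n. cinner (snd z n) (snd w n)) = cnj (\<Sum>n. cinner (snd w n) (snd z n))"
    by - (rule *; assumption)+
  then show ?thesis by (simp only: Kinner_def complex_cnj_add)
qed

lemma Kinner_self:
  assumes "z \<in> K2" shows "Kinner z z = complex_of_real ((Knorm z)\<^sup>2)"
proof -
  have "(\<Sum>n. cinner (x n) (x n)) = complex_of_real ((l2norm x)\<^sup>2)" if "x \<in> l2" for x :: "nat \<Rightarrow> 'a"
    unfolding cinner_self l2norm_square[OF that] by (rule suminf_of_real[symmetric]) (use that in \<open>simp add: l2_iff\<close>)
  then show ?thesis using assms by (simp only: Kinner_def Knorm_square K2_iff of_real_add)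
qed

lemma Ksum_empty: "Ksum f {} = K0"
  by (simp add: Ksum_def K0_def)

lemma Ksum_insert: "finite A \<Longrightarrow> i \<notin> A \<Longrightarrow> Ksum f (insert i A) = Kadd (f i) (Ksum f A)"
  by (simp add: Ksum_def Kadd_def)

lemma Ksum_K2: "(\<And>i. i \<in> A \<Longrightarrow> f i \<in> K2) \<Longrightarrow> Ksum f A \<in> K2"
  by (simp add: Ksum_def K2_iff l2_sum)

lemma Kscale_0: "Kscale 0 z = K0"
  by (simp add: Kscale_def K0_def)

lemma Kinner_Ksum_left:
  assumes "finite A" "w \<in> K2" "\<And>i. i \<in> A \<Longrightarrow> f i \<in> K2"
  shows "Kinner (Ksum f A) w = (\<Sum>i\<in>A. Kinner (f i) w)"
  using assms(1,3)
proof (induction A rule: finite_induct)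
  case empty
  show ?case using Kinner_scale_left[OF assms(2,2), of 0] by (simp add: Ksum_empty Kscale_0)
next
  case (insert i A)
  then show ?case using assms(2) by (simp add: Ksum_insert Kinner_add_left Ksum_K2)
qed

lemma Kinner_combination:
  assumes A: "finite A" and u: "\<And>i. i \<in> A \<Longrightarrow> u i \<in> K2"
  shows "Kinner (Ksum (\<lambda>i. Kscale (a i) (u i)) A) (Ksum (\<lambda>i. Kscale (a i) (u i)) A) =
    (\<Sum>i\<in>A. \<Sum>j\<in>A. a i * cnj (a j) * Kinner (u i) (u j))"
proof -
  let ?s = "Ksum (\<lambda>i. Kscale (a i) (u i)) A"
  have s: "?s \<in> K2" using u by (intro Ksum_K2 Kscale_K2)
  have 1: "Kinner ?s w = (\<Sum>i\<in>A. a i * Kinner (u i) w)" if "w \<in> K2" for w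
    using A u that by (simp add: Kinner_Ksum_left Kscale_K2 Kinner_scale_left)
  have "Kinner (u i) ?s = (\<Sum>j\<in>A. cnj (a j) * Kinner (u i) (u j))" if "i \<in> A" for i
  proof -
    have "Kinner (u i) ?s = cnj (Kinner ?s (u i))" using u that s by (intro Kinner_commute)
    also have "\<dots> = (\<Sum>j\<in>A. cnj (a j) * cnj (Kinner (u j) (u i)))" using u that by (simp add: 1)
    also have "\<dots> = (\<Sum>j\<in>A. cnj (a j) * Kinner (u i) (u j))"
      using u that Kinner_commute[of "u i"] by simp
    finally show ?thesis .
  qed
  then show ?thesis unfolding 1[OF s] by (simp add: sum_distrib_left mult.assoc)
qed

section \<open>Linear maps on \<open>K2\<close> and orbits of strict contractions\<close>

definition K_linear :: "('a::complex_inner l2sum \<Rightarrow> 'a l2sum) \<Rightarrow> bool" where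
  "K_linear T \<longleftrightarrow> T ` K2 \<subseteq> K2 \<and> (\<forall>z\<in>K2. \<forall>w\<in>K2. T (Kadd z w) = Kadd (T z) (T w)) \<and>
     (\<forall>c. \<forall>z\<in>K2. T (Kscale c z) = Kscale c (T z))"

lemma K_linear_K2: "K_linear T \<Longrightarrow> z \<in> K2 \<Longrightarrow> T z \<in> K2"
  by (auto simp: K_linear_def)

lemma K_linear_pow: "K_linear T \<Longrightarrow> K_linear (T ^^ n)"
proof (induction n)
  case (Suc n)
  then have "K_linear (T ^^ n)" by simp
  then show ?case using Suc.prems K_linear_K2[of "T ^^ n"]
    by (auto simp: K_linear_def image_subset_iff)
qed (simp add: K_linear_def)

lemma K_linear_K0: "K_linear T \<Longrightarrow> T K0 = K0"
  unfolding K_linear_def by (metis K0_K2 Kscale_0)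

lemma K_linear_combination:
  assumes T: "K_linear T" and A: "finite A" and u: "\<And>i. i \<in> A \<Longrightarrow> u i \<in> K2"
  shows "T (Ksum (\<lambda>i. Kscale (a i) (u i)) A) = Ksum (\<lambda>i. Kscale (a i) (T (u i))) A"
  using A u
proof (induction A rule: finite_induct)
  case (insert i A)
  have "Ksum (\<lambda>i. Kscale (a i) (u i)) A \<in> K2" "Kscale (a i) (u i) \<in> K2" "u i \<in> K2"
    using insert.prems by (auto intro!: Ksum_K2 Kscale_K2)
  then show ?case using insert T by (simp add: Ksum_insert K_linear_def)
qed (simp add: Ksum_empty K_linear_K0[OF T])

text \<open>For a strict contraction \<open>Q\<close> the defect form \<open>\<langle>z, w\<rangle> - \<langle>Q z, Q w\<rangle>\<close> is positive
  semidefinite, and \<open>z \<mapsto> (Q\<^sup>m z)\<^sub>m\<close> is isometric for it and turns \<open>Q\<close> into a backward shift.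
  This replaces the isometric dilation.\<close>

lemma strict_contraction_bound:
  fixes Q :: "'a::complex_inner l2sum \<Rightarrow> 'a l2sum" and x :: "nat set \<Rightarrow> 'a l2sum"
    and c :: "nat \<Rightarrow> complex" and d :: nat
  assumes Q: "K_linear Q" and Qr: "\<And>z. z \<in> K2 \<Longrightarrow> Knorm (Q z) \<le> r * Knorm z"
    and r: "0 \<le> r" "r < 1" and x: "\<And>I. x I \<in> K2"
  defines "y \<equiv> \<lambda>J. Ksum (\<lambda>k. Kscale (if k \<in> J then 0 else c k * fermion_sign k J) ((Q ^^ k) (x (insert k J)))) {..<d}"
  shows "(\<Sum>J | J \<subseteq> {..<d}. (Knorm (y J))\<^sup>2) \<le> (\<Sum>k<d. (cmod (c k))\<^sup>2) * (\<Sum>I | I \<subseteq> {..<d}. (Knorm (x I))\<^sup>2)"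
proof -
  define q where "q w = (Knorm w)\<^sup>2 - (Knorm (Q w))\<^sup>2" for w
  define g where "g z w = Kinner z w - Kinner (Q z) (Q w)" for z w
  let ?P = "{J. J \<subseteq> {..<d}}"
  have fin: "finite ?P" by simp
  have QnK: "(Q ^^ n) z \<in> K2" if "z \<in> K2" for n z
    using K_linear_K2[OF K_linear_pow[OF Q] that] .
  have q0: "0 \<le> q w" if "w \<in> K2" for w
  proof -
    have "Knorm (Q w) \<le> r * Knorm w" by (rule Qr[OF that])
    also have "\<dots> \<le> Knorm w" using r Knorm_nonneg[of w] by (simp add: mult_left_le_one_le)
    finally show ?thesis unfolding q_def using Knorm_nonneg[of "Q w"] by (simp add: power_mono)
  qed
  have gq: "g w w = complex_of_real (q w)" if "w \<in> K2" for w
    using that K_linear_K2[OF Q that] by (simp add: g_def q_def Kinner_self)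
  have g_comb: "complex_of_real (q (Ksum (\<lambda>i. Kscale (a i) (u i)) {..<d})) =
      (\<Sum>i<d. \<Sum>j<d. a i * cnj (a j) * g (u i) (u j))" if u: "\<And>i. u i \<in> K2" for a :: "nat \<Rightarrow> complex" and u
  proof -
    have "complex_of_real (q (Ksum (\<lambda>i. Kscale (a i) (u i)) {..<d})) =
      g (Ksum (\<lambda>i. Kscale (a i) (u i)) {..<d}) (Ksum (\<lambda>i. Kscale (a i) (u i)) {..<d})"
      using u by (intro gq[symmetric] Ksum_K2 Kscale_K2)
    also have "\<dots> = (\<Sum>i<d. \<Sum>j<d. a i * cnj (a j) * Kinner (u i) (u j)) -
       (\<Sum>i<d. \<Sum>j<d. a i * cnj (a j) * Kinner (Q (u i)) (Q (u j)))"
      using u K_linear_K2[OF Q] by (simp add: g_def K_linear_combination[OF Q] Kinner_combination)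
    finally show ?thesis by (simp add: g_def sum_subtractf right_diff_distrib)
  qed
  \<comment> \<open>Only finite stretches of orbits are compared: telescoping the defects over
    \<open>N\<close> steps recovers the square norms of \<open>y\<close> up to the factor
    \<open>1 - r ^ (2 * N)\<close>.\<close>
  have main: "(1 - r ^ (2 * N)) * (\<Sum>J\<in>?P. (Knorm (y J))\<^sup>2) \<le> (\<Sum>k<d. (cmod (c k))\<^sup>2) * (\<Sum>I\<in>?P. (Knorm (x I))\<^sup>2)" for N
  proof -
    define L where "L = int (N + d)"
    define M where "M = L + int d"
    \<comment> \<open>The orbit of \<open>x I\<close> sits at times \<open>0\<close> to
      \<open>N + d - 1\<close>. The additional \<open>d\<close> steps let \<open>Y m\<close> with
      \<open>m < N\<close> see every delay \<open>k < d\<close> untruncated.\<close>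
    define p where "p m I = (if 0 \<le> m \<and> m < int (N + d) then (Q ^^ nat m) (x I) else K0)" for m I
    have pK: "p m I \<in> K2" for m I by (simp add: p_def QnK x)
    have g0: "g K0 w = 0" if "w \<in> K2" for w
      using Kinner_scale_left[OF that that, of 0] Kinner_scale_left[OF that K_linear_K2[OF Q that], of 0]
      by (simp add: g_def K_linear_K0[OF Q] Kscale_0)
    define A where "A k m l n = (\<Sum>J | J \<subseteq> {..<d} \<and> k \<notin> J \<and> l \<notin> J.
        fermion_sign k J * fermion_sign l J * g (p m (insert k J)) (p n (insert l J)))" for k m l n
    define A' where "A' l m k n = (\<Sum>J | J \<subseteq> {..<d} \<and> k \<in> J \<and> l \<in> J.
        fermion_sign l J * fermion_sign k J * g (p m (J - {l})) (p n (J - {k})))" for k m l n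
    \<comment> \<open>Convolution of \<open>p\<close> with the annihilation matrices weighted by
      \<open>c\<close>; \<open>Y'\<close> below is its adjoint.\<close>
    define Y where "Y m J = Ksum (\<lambda>k. Kscale (if k \<in> J then 0 else c k * fermion_sign k J) (p (m + int k) (insert k J))) {..<d}" for m J
    define Y' where "Y' m J = Ksum (\<lambda>k. Kscale (if k \<in> J then cnj (c k) * fermion_sign k J else 0) (p (m - int k) (J - {k}))) {..<d}" for m J
    have YK: "Y m J \<in> K2" "Y' m J \<in> K2" for m J
      unfolding Y_def Y'_def by (intro Ksum_K2 Kscale_K2 pK)+
    have anti: "A k m l n + A' l m k n = (if k = l then (\<Sum>J\<in>?P. g (p m J) (p n J)) else 0)"
      if "k < d" "l < d" for k l m n
      unfolding A_def A'_def using sign_anticommute[OF that, of "\<lambda>I I'. g (p m I) (p n I')"] .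
    have zero: "A k m l n = 0" "A' k m l n = 0" if "m \<notin> {-L..L}" for k l m n
    proof -
      have "p m I = K0" for I using that by (auto simp: p_def L_def)
      then show "A k m l n = 0" "A' k m l n = 0" by (simp_all add: A_def A'_def g0 pK)
    qed
    have Ysum: "complex_of_real (\<Sum>J\<in>?P. q (Y m J)) =
       (\<Sum>k<d. \<Sum>l<d. c k * cnj (c l) * A k (m + int k) l (m + int l))" for m
    proof -
      have "complex_of_real (\<Sum>J\<in>?P. q (Y m J)) = (\<Sum>J\<in>?P. \<Sum>k<d. \<Sum>l<d.
         (if k \<in> J then 0 else c k * fermion_sign k J) * cnj (if l \<in> J then 0 else c l * fermion_sign l J) *
           g (p (m + int k) (insert k J)) (p (m + int l) (insert l J)))"
        unfolding of_real_sum Y_def by (simp only: g_comb[OF pK])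
      also have "\<dots> = (\<Sum>k<d. \<Sum>l<d. \<Sum>J\<in>?P.
         (if k \<in> J then 0 else c k * fermion_sign k J) * cnj (if l \<in> J then 0 else c l * fermion_sign l J) *
           g (p (m + int k) (insert k J)) (p (m + int l) (insert l J)))"
        by (subst sum.swap, intro sum.cong refl, rule sum.swap)
      also have "\<dots> = (\<Sum>k<d. \<Sum>l<d. c k * cnj (c l) * A k (m + int k) l (m + int l))"
        unfolding A_def sum_distrib_left
        by (intro sum.cong refl sum.mono_neutral_cong_right) (auto simp: cnj_fermion_sign)
      finally show ?thesis .
    qed
    have Y'sum: "complex_of_real (\<Sum>J\<in>?P. q (Y' m J)) =
       (\<Sum>k<d. \<Sum>l<d. c k * cnj (c l) * A' l (m - int l) k (m - int k))" for m
    proof -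
      have "complex_of_real (\<Sum>J\<in>?P. q (Y' m J)) = (\<Sum>J\<in>?P. \<Sum>l<d. \<Sum>k<d.
         (if l \<in> J then cnj (c l) * fermion_sign l J else 0) * cnj (if k \<in> J then cnj (c k) * fermion_sign k J else 0) *
           g (p (m - int l) (J - {l})) (p (m - int k) (J - {k})))"
        unfolding of_real_sum Y'_def by (simp only: g_comb[OF pK])
      also have "\<dots> = (\<Sum>l<d. \<Sum>k<d. \<Sum>J\<in>?P.
         (if l \<in> J then cnj (c l) * fermion_sign l J else 0) * cnj (if k \<in> J then cnj (c k) * fermion_sign k J else 0) *
           g (p (m - int l) (J - {l})) (p (m - int k) (J - {k})))"
        by (subst sum.swap, intro sum.cong refl, rule sum.swap)
      also have "\<dots> = (\<Sum>l<d. \<Sum>k<d. c k * cnj (c l) * A' l (m - int l) k (m - int k))"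
        unfolding A'_def sum_distrib_left
        by (intro sum.cong refl sum.mono_neutral_cong_right) (auto simp: cnj_fermion_sign)
      also have "\<dots> = (\<Sum>k<d. \<Sum>l<d. c k * cnj (c l) * A' l (m - int l) k (m - int k))"
        by (rule sum.swap)
      finally show ?thesis .
    qed
    have "complex_of_real ((\<Sum>m\<in>{-M..M}. \<Sum>J\<in>?P. q (Y m J)) + (\<Sum>m\<in>{-M..M}. \<Sum>J\<in>?P. q (Y' m J))) =
       (\<Sum>k<d. complex_of_real ((cmod (c k))\<^sup>2)) * (\<Sum>m\<in>{-L..L}. \<Sum>J\<in>?P. g (p m J) (p m J))"
      unfolding of_real_add of_real_sum[of _ "{-M..M}"] Ysum Y'sum
      by (rule anticommuting_convolution_identity[OF anti zero]) (simp_all add: M_def)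
    also have "\<dots> = complex_of_real ((\<Sum>k<d. (cmod (c k))\<^sup>2) * (\<Sum>m\<in>{-L..L}. \<Sum>J\<in>?P. q (p m J)))"
      by (simp add: gq pK)
    finally have id: "(\<Sum>m\<in>{-M..M}. \<Sum>J\<in>?P. q (Y m J)) + (\<Sum>m\<in>{-M..M}. \<Sum>J\<in>?P. q (Y' m J)) =
       (\<Sum>k<d. (cmod (c k))\<^sup>2) * (\<Sum>m\<in>{-L..L}. \<Sum>J\<in>?P. q (p m J))"
      using of_real_eq_iff by blast
    have tele: "(\<Sum>m<n. q ((Q ^^ m) w)) = (Knorm w)\<^sup>2 - (Knorm ((Q ^^ n) w))\<^sup>2" for n w
      by (induction n) (simp_all add: q_def)
    have Y_pow: "Y (int m) J = (Q ^^ m) (y J)" if "m < N" for m J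
    proof -
      have "p (int m + int k) I = (Q ^^ m) ((Q ^^ k) (x I))" if "k < d" for k I
        using \<open>m < N\<close> that by (simp add: p_def funpow_add nat_add_distrib)
      then show ?thesis unfolding Y_def y_def
        by (subst K_linear_combination[OF K_linear_pow[OF Q]]) (auto simp: QnK x Ksum_def)
    qed
    have pow_small: "(Knorm ((Q ^^ n) w))\<^sup>2 \<le> r ^ (2 * n) * (Knorm w)\<^sup>2" if w: "w \<in> K2" for n w
    proof -
      have "Knorm ((Q ^^ n) w) \<le> r ^ n * Knorm w"
      proof (induction n)
        case (Suc n)
        have "Knorm ((Q ^^ Suc n) w) \<le> r * Knorm ((Q ^^ n) w)" using Qr[OF QnK[OF w]] by simp
        also have "\<dots> \<le> r * (r ^ n * Knorm w)" using Suc r by (intro mult_left_mono)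
        finally show ?case by (simp add: mult.assoc)
      qed simp
      then have "(Knorm ((Q ^^ n) w))\<^sup>2 \<le> (r ^ n * Knorm w)\<^sup>2"
        by (intro power_mono Knorm_nonneg)
      then show ?thesis by (simp add: power_mult_distrib power_mult[symmetric] mult.commute)
    qed
    have yK: "y J \<in> K2" for J unfolding y_def by (intro Ksum_K2 Kscale_K2 QnK x)
    \<comment> \<open>The defects along the orbit of \<open>y J\<close> telescope, and what remains
      after \<open>N\<close> steps is at most \<open>r ^ (2 * N)\<close> times the initial square
      norm.\<close>
    have "(1 - r ^ (2 * N)) * (\<Sum>J\<in>?P. (Knorm (y J))\<^sup>2) \<le> (\<Sum>J\<in>?P. \<Sum>m<N. q ((Q ^^ m) (y J)))"
      unfolding sum_distrib_left tele
      by (intro sum_mono) (use pow_small[OF yK, of N] in \<open>simp add: algebra_simps\<close>)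
    also have "\<dots> = (\<Sum>m<N. \<Sum>J\<in>?P. q (Y (int m) J))"
      by (subst sum.swap) (simp add: Y_pow)
    also have "\<dots> = (\<Sum>m\<in>int ` {..<N}. \<Sum>J\<in>?P. q (Y m J))"
      by (subst sum.reindex) auto
    also have "\<dots> \<le> (\<Sum>m\<in>{-M..M}. \<Sum>J\<in>?P. q (Y m J))"
      by (intro sum_mono2 sum_nonneg q0 YK) (auto simp: M_def L_def)
    also have "\<dots> \<le> (\<Sum>k<d. (cmod (c k))\<^sup>2) * (\<Sum>m\<in>{-L..L}. \<Sum>J\<in>?P. q (p m J))"
    proof -
      have "0 \<le> (\<Sum>m\<in>{-M..M}. \<Sum>J\<in>?P. q (Y' m J))" by (intro sum_nonneg q0 YK)
      then show ?thesis using id by linarith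
    qed
    \<comment> \<open>The total defect along the orbit of each \<open>x I\<close> is at most its
      initial square norm, whatever the length of the orbit.\<close>
    also have "\<dots> \<le> (\<Sum>k<d. (cmod (c k))\<^sup>2) * (\<Sum>I\<in>?P. (Knorm (x I))\<^sup>2)"
    proof (intro mult_left_mono sum_nonneg zero_le_power2)
      have "(\<Sum>m\<in>{-L..L}. \<Sum>J\<in>?P. q (p m J)) = (\<Sum>m\<in>int ` {..<N+d}. \<Sum>J\<in>?P. q (p m J))"
      proof (rule sum.mono_neutral_right)
        show "\<forall>m\<in>{-L..L} - int ` {..<N+d}. (\<Sum>J\<in>?P. q (p m J)) = 0"
        proof
          fix m assume "m \<in> {-L..L} - int ` {..<N+d}"
          then have "\<not> (0 \<le> m \<and> m < int (N + d))" by (cases m) auto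
          then have "p m J = K0" for J unfolding p_def by (simp only: if_False)
          moreover have "q K0 = 0" by (simp add: q_def K_linear_K0[OF Q])
          ultimately show "(\<Sum>J\<in>?P. q (p m J)) = 0" by simp
        qed
      qed (auto simp: L_def)
      also have "\<dots> = (\<Sum>m<N+d. \<Sum>J\<in>?P. q ((Q ^^ m) (x J)))"
        by (subst sum.reindex) (auto simp: p_def)
      also have "\<dots> = (\<Sum>J\<in>?P. \<Sum>m<N+d. q ((Q ^^ m) (x J)))" by (rule sum.swap)
      also have "\<dots> \<le> (\<Sum>J\<in>?P. (Knorm (x J))\<^sup>2)" unfolding tele by (intro sum_mono) simp
      finally show "(\<Sum>m\<in>{-L..L}. \<Sum>J\<in>?P. q (p m J)) \<le> (\<Sum>J\<in>?P. (Knorm (x J))\<^sup>2)" .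
    qed
    finally show ?thesis .
  qed
  have "(\<lambda>N. r ^ (2 * N)) \<longlonglongrightarrow> 0"
    unfolding power_mult using r by (intro LIMSEQ_power_zero) (simp add: power_less_one_iff abs_square_less_1)
  then have "(\<lambda>N. (1 - r ^ (2 * N)) * (\<Sum>J\<in>?P. (Knorm (y J))\<^sup>2)) \<longlonglongrightarrow> (1 - 0) * (\<Sum>J\<in>?P. (Knorm (y J))\<^sup>2)"
    by (intro tendsto_intros)
  then show ?thesis using main by (intro LIMSEQ_le_const2[where X = "\<lambda>N. (1 - r ^ (2 * N)) * _ "]) auto
qed

section \<open>Fock vectors\<close>

context car_family begin

text \<open>If \<open>w\<close> is killed by all earlier operators but not by \<open>C d\<close>,
  replace it by \<open>C d w\<close>: this is killed by \<open>C d\<close>, whose square is zero,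
  and by the earlier operators through anticommutation.\<close>

lemma vacuum_exists:
  assumes "(v::'a) \<noteq> 0" shows "\<exists>\<Omega>. norm \<Omega> = 1 \<and> (\<forall>k<d. C k \<Omega> = 0)"
proof -
  have "\<exists>w. w \<noteq> 0 \<and> (\<forall>k<d. C k w = 0)"
  proof (induction d)
    case 0
    show ?case using assms by auto
  next
    case (Suc d)
    then obtain w where w: "w \<noteq> 0" "\<And>k. k < d \<Longrightarrow> C k w = 0" by blast
    show ?case
    proof (cases "C d w = 0")
      case True
      then show ?thesis using w by (auto simp: less_Suc_eq)
    next
      case False
      have "C d (C d w) + C d (C d w) = 0" by (rule CC)
      then have "2 *\<^sub>R C d (C d w) = 0" by (simp only: scaleR_2)
      then have "C d (C d w) = 0" by simp
      moreover have "C k (C d w) = 0" if "k < d" for k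
        using CC[of k d w] w(2)[OF that] by simp
      ultimately show ?thesis using False by (auto simp: less_Suc_eq)
    qed
  qed
  then obtain w where w: "w \<noteq> 0" "\<And>k. k < d \<Longrightarrow> C k w = 0" by blast
  then have "norm (complex_of_real (1 / norm w) *\<^sub>C w) = 1"
    by (simp add: norm_scaleC norm_divide)
  moreover have "C k (complex_of_real (1 / norm w) *\<^sub>C w) = 0" if "k < d" for k
    using w(2)[OF that] by (simp only: C_scaleC scaleC_zero_right)
  ultimately show ?thesis by blast
qed

text \<open>The creation operators of the indices in \<open>J\<close> below \<open>n\<close> act on
  the vacuum, the largest index outermost.\<close>

primrec fock :: "'a \<Rightarrow> nat \<Rightarrow> nat set \<Rightarrow> 'a" where
  "fock \<Omega> 0 J = \<Omega>"
| "fock \<Omega> (Suc n) J = (if n \<in> J then D n (fock \<Omega> n J) else fock \<Omega> n J)"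

lemma fock_insert_ge: "n \<le> k \<Longrightarrow> fock \<Omega> n (insert k J) = fock \<Omega> n J"
  by (induction n) auto

lemma C_D_anticommute: "k \<noteq> l \<Longrightarrow> C k (D l x) = - D l (C k x)"
  using CD[of k l x] by (simp add: eq_neg_iff_add_eq_0)

text \<open>\<open>C k\<close> moves through every creation operator of a different index up to sign
  and finally meets the vacuum; both alternatives ensure that \<open>D k\<close> does not
  occur.\<close>

lemma C_fock_zero:
  assumes vac: "\<And>k. k < N \<Longrightarrow> C k \<Omega> = 0"
  shows "k < N \<Longrightarrow> k \<notin> J \<or> n \<le> k \<Longrightarrow> C k (fock \<Omega> n J) = 0"
proof (induction n)
  case (Suc n)
  then have IH: "C k (fock \<Omega> n J) = 0" by auto
  show ?case
  proof (cases "n \<in> J")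
    case True
    then have "k \<noteq> n" using Suc.prems by auto
    then show ?thesis using True IH by (simp add: C_D_anticommute)
  qed (simp add: IH)
qed (simp add: vac)

text \<open>On vectors killed by \<open>C n\<close>, \<open>norm_C_D\<close> makes
  \<open>D n\<close> isometric.\<close>

lemma norm_fock:
  assumes vac: "\<And>k. k < N \<Longrightarrow> C k \<Omega> = 0"
  shows "n \<le> N \<Longrightarrow> norm (fock \<Omega> n J) = norm \<Omega>"
proof (induction n)
  case (Suc n)
  then have "C n (fock \<Omega> n J) = 0" by (intro C_fock_zero[OF vac]) auto
  then have "(norm (D n (fock \<Omega> n J)))\<^sup>2 = (norm (fock \<Omega> n J))\<^sup>2"
    using norm_C_D[of n "fock \<Omega> n J"] by simp
  then show ?case using Suc by simp
qed simp

text \<open>\<open>C k\<close> picks up a sign at each creation operator of index above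
  \<open>k\<close>, then cancels \<open>D k\<close>. The set is cut at \<open>n\<close> because
  larger indices have not been applied yet.\<close>

lemma C_fock_insert:
  assumes vac: "\<And>k. k < N \<Longrightarrow> C k \<Omega> = 0"
  shows "n \<le> N \<Longrightarrow> k < n \<Longrightarrow> k \<notin> J \<Longrightarrow>
    C k (fock \<Omega> n (insert k J)) = fermion_sign k (J \<inter> {..<n}) *\<^sub>C fock \<Omega> n J"
proof (induction n)
  case (Suc n)
  show ?case
  proof (cases "k = n")
    case True
    have "C n (fock \<Omega> n J) = 0" using Suc.prems True by (intro C_fock_zero[OF vac]) auto
    then have "C n (D n (fock \<Omega> n J)) = fock \<Omega> n J" using CD[of n n "fock \<Omega> n J"] by simp
    moreover have "{l \<in> J \<inter> {..<Suc n}. n < l} = {}" by auto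
    then have "fermion_sign n (J \<inter> {..<Suc n}) = 1" unfolding fermion_sign_def by (simp only: card.empty power_0)
    ultimately show ?thesis using True Suc.prems by (simp add: fock_insert_ge scaleC_one)
  next
    case False
    then have kn: "k < n" using Suc.prems by simp
    then have IH: "C k (fock \<Omega> n (insert k J)) = fermion_sign k (J \<inter> {..<n}) *\<^sub>C fock \<Omega> n J"
      using Suc by simp
    show ?thesis
    proof (cases "n \<in> J")
      case True
      have "J \<inter> {..<Suc n} = insert n (J \<inter> {..<n})" using True by auto
      then have "fermion_sign k (J \<inter> {..<Suc n}) = - fermion_sign k (J \<inter> {..<n})" using kn by (simp add: fermion_sign_insert)
      moreover have "- (c *\<^sub>C x) = (- c) *\<^sub>C x" for c and x :: 'a
        by (simp add: scaleC_minus1[symmetric] scaleC_scaleC)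
      ultimately show ?thesis using True False IH by (simp add: C_D_anticommute D_scaleC)
    next
      case n: False
      have "J \<inter> {..<Suc n} = J \<inter> {..<n}" using n by (auto simp: less_Suc_eq)
      then show ?thesis using n False IH by simp
    qed
  qed
qed simp

end

section \<open>Similarity forces square-summable weighted coefficients\<close>

text \<open>The sums over \<open>J\<close> and over its complement add up to the full sum. Pairing
  the two therefore loses only the factor 4, independently of \<open>d\<close>.\<close>

lemma sum_Pow_complement_bound:
  fixes G :: "nat \<Rightarrow> real"
  shows "2 ^ d * (\<Sum>k<d. G k)\<^sup>2 \<le> 4 * (\<Sum>J | J \<subseteq> {..<d}. (\<Sum>k\<in>{..<d} - J. G k)\<^sup>2)"
proof -
  let ?P = "{J. J \<subseteq> {..<d}}"
  define S where "S J = (\<Sum>k\<in>{..<d} - J. G k)" for J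
  have compl: "S J + S ({..<d} - J) = (\<Sum>k<d. G k)" if "J \<in> ?P" for J
  proof -
    have "{..<d} - ({..<d} - J) = J" using that by auto
    then show ?thesis using that finite_subset[of J "{..<d}"]
      unfolding S_def by (subst sum.union_disjoint[symmetric]) (auto intro: sum.cong)
  qed
  have "(\<Sum>J\<in>?P. (S ({..<d} - J))\<^sup>2) = (\<Sum>J\<in>?P. (S J)\<^sup>2)"
    by (rule sum.reindex_bij_witness[of _ "\<lambda>J. {..<d} - J" "\<lambda>J. {..<d} - J"]) auto
  then have two: "4 * (\<Sum>J\<in>?P. (S J)\<^sup>2) = (\<Sum>J\<in>?P. 2 * (S J)\<^sup>2 + 2 * (S ({..<d} - J))\<^sup>2)"
    by (simp add: sum.distrib sum_distrib_left[symmetric])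
  have "(\<Sum>J\<in>?P. (\<Sum>k<d. G k)\<^sup>2) \<le> (\<Sum>J\<in>?P. 2 * (S J)\<^sup>2 + 2 * (S ({..<d} - J))\<^sup>2)"
  proof (rule sum_mono)
    fix J assume "J \<in> ?P"
    then have "(\<Sum>k<d. G k)\<^sup>2 = (S J + S ({..<d} - J))\<^sup>2" by (simp add: compl)
    also have "\<dots> \<le> 2 * (S J)\<^sup>2 + 2 * (S ({..<d} - J))\<^sup>2"
      using sum_squares_bound[of "S J" "S ({..<d} - J)"] by (simp add: power2_sum)
    finally show "(\<Sum>k<d. G k)\<^sup>2 \<le> 2 * (S J)\<^sup>2 + 2 * (S ({..<d} - J))\<^sup>2" .
  qed
  moreover have "card ?P = 2 ^ d" using card_Pow[of "{..<d}"] by (simp add: Pow_def)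
  ultimately show ?thesis unfolding two[unfolded S_def] S_def by simp
qed

section \<open>Norms and linearity for operators on \<open>K2\<close>, including
  \<open>Rop\<close>\<close>

lemma bounded_K_op_linear: "bounded_K_op T \<Longrightarrow> K_linear T"
  by (simp add: bounded_K_op_def K_linear_def)

lemma bounded_K_op_bound: "bounded_K_op T \<Longrightarrow> \<exists>M. \<forall>z\<in>K2. Knorm (T z) \<le> M * Knorm z"
  by (simp add: bounded_K_op_def)

lemma K_linear_comp:
  assumes S: "K_linear S" and T: "K_linear T" shows "K_linear (\<lambda>z. S (T z))"
  using assms K_linear_K2[OF T] unfolding K_linear_def by (auto simp: image_subset_iff)

lemma K_linear_Kscale: "K_linear (Kscale c)"
  unfolding K_linear_def using Kscale_K2[of _ c]
  by (auto simp: Kscale_def Kadd_def scaleC_add_right scaleC_scaleC mult.commute)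

lemma Knorm_Kscale: "z \<in> K2 \<Longrightarrow> Knorm (Kscale c z) = cmod c * Knorm z"
proof -
  assume z: "z \<in> K2"
  have l: "(l2norm (\<lambda>k. c *\<^sub>C x k))\<^sup>2 = (cmod c)\<^sup>2 * (l2norm x)\<^sup>2" if "x \<in> l2" for x :: "nat \<Rightarrow> 'a"
    unfolding l2norm_square[OF that] l2norm_square[OF l2_scaleC[OF that]] norm_scaleC power_mult_distrib
    by (rule suminf_mult) (use that in \<open>simp add: l2_iff\<close>)
  have "(Knorm (Kscale c z))\<^sup>2 = (cmod c * Knorm z)\<^sup>2"
    using z by (simp add: Knorm_square power_mult_distrib Kscale_def l K2_iff distrib_left)
  then show ?thesis by (simp add: power2_eq_iff_nonneg Knorm_nonneg)
qed

lemma norm_component_le_Knorm: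
  assumes "z \<in> K2" shows "norm (fst z i) \<le> Knorm z"
proof (rule power2_le_imp_le[OF _ Knorm_nonneg])
  show "(norm (fst z i))\<^sup>2 \<le> (Knorm z)\<^sup>2"
    using assms partial_sum_le_l2norm[of "fst z" "{i}"] by (simp add: Knorm_square K2_iff add_increasing2)
qed

lemma K_linear_Rop:
  assumes G: "bounded_l2_op B \<Gamma>" shows "K_linear (Rop \<Gamma>)"
  unfolding K_linear_def
proof (intro conjI ballI allI)
  show "Rop \<Gamma> ` K2 \<subseteq> K2"
    using G by (auto simp: Rop_def K2_iff bounded_l2_op_def intro!: l2_add bshift_l2 fshift_l2)
next
  fix z w :: "'a l2sum" assume "z \<in> K2" "w \<in> K2"
  then show "Rop \<Gamma> (Kadd z w) = Kadd (Rop \<Gamma> z) (Rop \<Gamma> w)"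
    using G by (auto simp: Rop_def Kadd_def K2_iff bounded_l2_op_def bshift_def fshift_def)
next
  fix c and z :: "'a l2sum" assume "z \<in> K2"
  then show "Rop \<Gamma> (Kscale c z) = Kscale c (Rop \<Gamma> z)"
    using G by (auto simp: Rop_def Kscale_def K2_iff bounded_l2_op_def bshift_def fshift_def scaleC_add_right)
qed

context car_hilbert begin

text \<open>The contraction obtained by conjugating \<open>R\<close> with \<open>T\<close> is damped
  by \<open>r\<close> and inserted in \<open>strict_contraction_bound\<close>, tested on Fock
  vectors. This bounds the square of the weighted sum by a constant times the sum itself, with a
  constant free of \<open>d\<close> and \<open>r\<close>.\<close>

lemma weighted_coefficients_bounded:
  assumes a: "summable (\<lambda>n. (cmod (\<alpha> n))\<^sup>2)" and v: "(v::'a) \<noteq> 0"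
    and sim: "similar_to_contraction (Rop (Hankel_op \<alpha> C))"
  shows "\<exists>S. \<forall>d. (\<Sum>k<d. (real (Suc k) * cmod (\<alpha> k))\<^sup>2) \<le> S"
proof -
  define R where "R = Rop (Hankel_op \<alpha> C)"
  have R: "K_linear R" unfolding R_def by (rule K_linear_Rop[OF bounded_l2_op_Hankel[OF a]])
  obtain T where T: "invertible_K_op T"
    and Tc: "\<And>z. z \<in> K2 \<Longrightarrow> Knorm (inv_into K2 T (R (T z))) \<le> Knorm z"
    using sim unfolding similar_to_contraction_def R_def by blast
  define Ti where "Ti = inv_into K2 T"
  have TK: "K_linear T" and TiK: "K_linear Ti" and bij: "bij_betw T K2 K2"
    using T by (auto simp: invertible_K_op_def Ti_def bounded_K_op_linear)
  have TTi: "T (Ti z) = z" if "z \<in> K2" for z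
    using bij that by (simp add: Ti_def bij_betw_inv_into_right)
  obtain M1 where M1: "\<And>z. z \<in> K2 \<Longrightarrow> Knorm (Ti z) \<le> M1 * Knorm z"
    using bounded_K_op_bound[of Ti] T by (auto simp: invertible_K_op_def Ti_def)
  obtain M2 where M2: "\<And>z. z \<in> K2 \<Longrightarrow> Knorm (T z) \<le> M2 * Knorm z"
    using bounded_K_op_bound[of T] T by (auto simp: invertible_K_op_def)
  define M where "M = M1\<^sup>2 * M2\<^sup>2"
  define W where "W d = (\<Sum>k<d. (real (Suc k) * cmod (\<alpha> k))\<^sup>2)" for d
  have est: "(\<Sum>k<d. r ^ k * (real (Suc k) * cmod (\<alpha> k))\<^sup>2)\<^sup>2 \<le> 4 * M * W d" if r: "0 \<le> r" "r < 1" for r d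
  proof -
    obtain \<Omega> where \<Omega>: "norm \<Omega> = 1" and vac: "\<And>k. k < d \<Longrightarrow> C k \<Omega> = 0"
      using vacuum_exists[OF v, of d] by blast
    define u where "u = fock \<Omega> d"
    have nu: "norm (u J) = 1" for J unfolding u_def using norm_fock[OF vac, where n = d] \<Omega> by simp
    have Cu: "C k (u (insert k J)) = fermion_sign k J *\<^sub>C u J" if "k < d" "k \<notin> J" "J \<subseteq> {..<d}" for k J
      unfolding u_def using C_fock_insert[OF vac, where n = d and k = k and J = J] that by (simp add: Int_absorb2)
    define Q where "Q z = Kscale (complex_of_real r) (Ti (R (T z)))" for z
    have Q: "K_linear Q" unfolding Q_def
      by (intro K_linear_comp[OF K_linear_Kscale] K_linear_comp[OF TiK] K_linear_comp[OF R TK])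
    have Qr: "Knorm (Q z) \<le> r * Knorm z" if z: "z \<in> K2" for z
    proof -
      have "Ti (R (T z)) \<in> K2" using z by (intro K_linear_K2[OF TiK] K_linear_K2[OF R] K_linear_K2[OF TK])
      then show ?thesis unfolding Q_def using Tc[OF z] r by (simp add: Knorm_Kscale Ti_def mult_left_mono)
    qed
    \<comment> \<open>The components, indexed by \<open>I\<close>, of a maximally entangled Fock
      vector. Applying \<open>R\<close> once in advance makes the iterate of order \<open>k\<close>
      involve \<open>R ^^ Suc k\<close>, whose corner carries \<open>Suc k\<close> times
      \<open>\<alpha> k\<close>.\<close>
    define x where "x I = Ti (R (delta0 (u I)))" for I
    have RK: "(R ^^ n) (delta0 h) \<in> K2" for n h
      by (rule K_linear_K2[OF K_linear_pow[OF R] delta0_K2])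
    have RdK: "R (delta0 h) \<in> K2" for h by (rule K_linear_K2[OF R delta0_K2])
    have xK: "x I \<in> K2" for I unfolding x_def by (rule K_linear_K2[OF TiK RdK])
    have xn: "(Knorm (x I))\<^sup>2 \<le> M1\<^sup>2" for I
    proof -
      have "Ti (delta0 (u I)) \<in> K2" by (rule K_linear_K2[OF TiK delta0_K2])
      from Tc[OF this] have "Knorm (x I) \<le> Knorm (Ti (delta0 (u I)))"
        by (simp add: x_def TTi delta0_K2 Ti_def[symmetric])
      also have "\<dots> \<le> M1" using M1[OF delta0_K2, of "u I"] by (simp add: Knorm_delta0 nu)
      finally show ?thesis by (intro power_mono Knorm_nonneg)
    qed
    have Qx: "(Q ^^ k) (x I) = Kscale (complex_of_real r ^ k) (Ti ((R ^^ Suc k) (delta0 (u I))))" for k I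
    proof (induction k)
      case 0
      show ?case by (simp add: x_def Kscale_def scaleC_one)
    next
      case (Suc k)
      let ?w = "(R ^^ Suc k) (delta0 (u I))"
      have w: "?w \<in> K2" "Ti ?w \<in> K2" by (rule RK, rule K_linear_K2[OF TiK RK])
      have "(Q ^^ Suc k) (x I) = Q (Kscale (complex_of_real r ^ k) (Ti ?w))" using Suc by simp
      also have "\<dots> = Kscale (complex_of_real r ^ k) (Q (Ti ?w))"
        using Q w by (simp only: K_linear_def)
      also have "\<dots> = Kscale (complex_of_real r ^ Suc k) (Ti (R ?w))"
        unfolding Q_def TTi[OF w(1)] by (simp add: Kscale_def scaleC_scaleC mult.commute)
      finally show ?case by simp
    qed
    \<comment> \<open>The conjugate of the weighted coefficient, so that its product with the corner
      entry is the nonnegative real \<open>G k\<close>.\<close>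
    define c where "c k = of_nat (Suc k) * cnj (\<alpha> k)" for k
    define G where "G k = r ^ k * (real (Suc k) * cmod (\<alpha> k))\<^sup>2" for k
    define y where "y J = Ksum (\<lambda>k. Kscale (if k \<in> J then 0 else c k * fermion_sign k J) ((Q ^^ k) (x (insert k J)))) {..<d}" for J
    have QxK: "(Q ^^ k) (x I) \<in> K2" for k I by (rule K_linear_K2[OF K_linear_pow[OF Q] xK])
    have yK: "y J \<in> K2" for J unfolding y_def by (intro Ksum_K2 Kscale_K2 QxK)
    have cG: "c k * complex_of_real r ^ k * (of_nat (Suc k) * \<alpha> k) = complex_of_real (G k)" for k
    proof -
      have "complex_of_real (G k) = complex_of_real r ^ k * (of_nat (Suc k) * of_nat (Suc k) * (\<alpha> k * cnj (\<alpha> k)))"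
        unfolding G_def power_mult_distrib complex_norm_square[symmetric] of_real_mult
        by (simp add: power2_eq_square del: of_nat_Suc)
      then show ?thesis by (simp add: c_def mult_ac del: of_nat_Suc)
    qed
    \<comment> \<open>The sign from the matrix model equals the sign from
      \<open>C_fock_insert\<close>, so they cancel. All terms are then nonnegative multiples of the
      single vector \<open>u J\<close> and add up coherently.\<close>
    have comp: "fst (T (y J)) 0 = complex_of_real (\<Sum>k\<in>{..<d} - J. G k) *\<^sub>C u J" if J: "J \<subseteq> {..<d}" for J
    proof -
      have TQ: "T ((Q ^^ k) (x I)) = Kscale (complex_of_real r ^ k) ((R ^^ Suc k) (delta0 (u I)))" for k I
      proof -
        have "Ti ((R ^^ Suc k) (delta0 (u I))) \<in> K2" by (rule K_linear_K2[OF TiK RK])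
        then show ?thesis unfolding Qx using TK TTi[OF RK] by (simp only: K_linear_def)
      qed
      have "fst (T (y J)) 0 = (\<Sum>k<d. (if k \<in> J then 0 else c k * fermion_sign k J) *\<^sub>C
          fst (T ((Q ^^ k) (x (insert k J)))) 0)"
        unfolding y_def using QxK by (subst K_linear_combination[OF TK]) (auto simp: Ksum_def Kscale_def)
      also have "\<dots> = (\<Sum>k<d. if k \<in> J then 0 else complex_of_real (G k) *\<^sub>C u J)"
      proof (intro sum.cong refl)
        fix k assume k: "k \<in> {..<d}"
        have "fst (T ((Q ^^ k) (x (insert k J)))) 0 =
            complex_of_real r ^ k *\<^sub>C ((of_nat (Suc k) * \<alpha> k) *\<^sub>C C k (u (insert k J)))"
          unfolding TQ R_def Rop_pow by (simp add: Kscale_def del: of_nat_Suc)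
        moreover have "(c k * fermion_sign k J) *\<^sub>C complex_of_real r ^ k *\<^sub>C ((of_nat (Suc k) * \<alpha> k) *\<^sub>C (fermion_sign k J *\<^sub>C u J))
            = complex_of_real (G k) *\<^sub>C u J"
        proof -
          have "c k * fermion_sign k J * (complex_of_real r ^ k * (of_nat (Suc k) * \<alpha> k * fermion_sign k J)) =
              (fermion_sign k J * fermion_sign k J) * complex_of_real (G k)"
            unfolding cG[symmetric] by (simp only: mult_ac)
          then show ?thesis unfolding scaleC_scaleC fermion_sign_sq by (simp only: mult.left_neutral)
        qed
        ultimately show "(if k \<in> J then 0 else c k * fermion_sign k J) *\<^sub>C fst (T ((Q ^^ k) (x (insert k J)))) 0 =
            (if k \<in> J then 0 else complex_of_real (G k) *\<^sub>C u J)"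
          using k J Cu[of k J] by simp
      qed
      also have "\<dots> = (\<Sum>k\<in>{..<d} - J. complex_of_real (G k) *\<^sub>C u J)"
        by (rule sum.mono_neutral_cong_right) auto
      finally show ?thesis by (simp only: of_real_sum scaleC_sum_left)
    qed
    have lower: "(\<Sum>k\<in>{..<d} - J. G k)\<^sup>2 \<le> M2\<^sup>2 * (Knorm (y J))\<^sup>2" if J: "J \<subseteq> {..<d}" for J
    proof -
      have "\<bar>\<Sum>k\<in>{..<d} - J. G k\<bar> = norm (fst (T (y J)) 0)"
        unfolding comp[OF J] norm_scaleC nu norm_of_real by simp
      also have "\<dots> \<le> Knorm (T (y J))" by (rule norm_component_le_Knorm[OF K_linear_K2[OF TK yK]])
      also have "\<dots> \<le> M2 * Knorm (y J)" by (rule M2[OF yK])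
      finally have "\<bar>\<Sum>k\<in>{..<d} - J. G k\<bar>\<^sup>2 \<le> (M2 * Knorm (y J))\<^sup>2" by (intro power_mono) auto
      then show ?thesis by (simp add: power_mult_distrib)
    qed
    have W: "(\<Sum>k<d. (cmod (c k))\<^sup>2) = W d"
      unfolding W_def c_def by (simp add: norm_mult del: of_nat_Suc)
    have W0: "0 \<le> W d" unfolding W_def by (simp add: sum_nonneg)
    have "2 ^ d * (\<Sum>k<d. G k)\<^sup>2 \<le> 4 * (\<Sum>J | J \<subseteq> {..<d}. (\<Sum>k\<in>{..<d} - J. G k)\<^sup>2)"
      by (rule sum_Pow_complement_bound)
    also have "\<dots> \<le> 4 * (\<Sum>J | J \<subseteq> {..<d}. M2\<^sup>2 * (Knorm (y J))\<^sup>2)"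
      using lower by (intro mult_left_mono sum_mono) auto
    also have "\<dots> = 4 * M2\<^sup>2 * (\<Sum>J | J \<subseteq> {..<d}. (Knorm (y J))\<^sup>2)"
      by (simp add: sum_distrib_left[symmetric])
    also have "\<dots> \<le> 4 * M2\<^sup>2 * (W d * (\<Sum>I | I \<subseteq> {..<d}. (Knorm (x I))\<^sup>2))"
      using strict_contraction_bound[OF Q Qr r, where x = x and c = c and d = d, OF _ xK] unfolding W y_def by (intro mult_left_mono) auto
    also have "\<dots> \<le> 4 * M2\<^sup>2 * (W d * (\<Sum>I | I \<subseteq> {..<d}. M1\<^sup>2))"
      using W0 xn by (intro mult_left_mono sum_mono) auto
    also have "(\<Sum>I | I \<subseteq> {..<d}. M1\<^sup>2) = 2 ^ d * M1\<^sup>2"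
      using card_Pow[of "{..<d}"] by (simp add: Pow_def)
    finally have "2 ^ d * (\<Sum>k<d. G k)\<^sup>2 \<le> 2 ^ d * (4 * M * W d)"
      by (simp add: M_def mult_ac)
    then show ?thesis unfolding G_def by simp
  qed
  \<comment> \<open>Here \<open>r\<close> tends to 1 along \<open>1 - 1 / (n + 1)\<close>, which
    removes the damping from the left-hand side.\<close>
  have "(W d)\<^sup>2 \<le> 4 * M * W d" for d
  proof (rule LIMSEQ_le_const2)
    have "(\<lambda>n. 1 + - inverse (real (Suc n))) \<longlonglongrightarrow> 1"
      by (rule LIMSEQ_inverse_real_of_nat_add_minus)
    then have "(\<lambda>n. (\<Sum>k<d. (1 + - inverse (real (Suc n))) ^ k * (real (Suc k) * cmod (\<alpha> k))\<^sup>2)\<^sup>2)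
        \<longlonglongrightarrow> (\<Sum>k<d. 1 ^ k * (real (Suc k) * cmod (\<alpha> k))\<^sup>2)\<^sup>2"
      by (intro tendsto_power tendsto_sum tendsto_mult tendsto_const)
    then show "(\<lambda>n. (\<Sum>k<d. (1 + - inverse (real (Suc n))) ^ k * (real (Suc k) * cmod (\<alpha> k))\<^sup>2)\<^sup>2) \<longlonglongrightarrow> (W d)\<^sup>2"
      by (simp add: W_def)
    have "0 \<le> 1 + - inverse (real (Suc n))" "1 + - inverse (real (Suc n)) < 1" for n
      by (simp_all add: inverse_le_1_iff)
    then show "\<exists>N. \<forall>n\<ge>N. (\<Sum>k<d. (1 + - inverse (real (Suc n))) ^ k * (real (Suc k) * cmod (\<alpha> k))\<^sup>2)\<^sup>2 \<le> 4 * M * W d"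
      using est by blast
  qed
  moreover have "0 \<le> W d" "0 \<le> M" for d by (simp_all add: W_def M_def sum_nonneg)
  \<comment> \<open>Cancelling one factor \<open>W d\<close> turns the quadratic estimate into a
    bound uniform in \<open>d\<close>; the case \<open>W d = 0\<close> is separate.\<close>
  ultimately have "W d \<le> 4 * M" for d
    using mult_le_cancel_right_pos[of "W d" "W d" "4 * M"]
    by (cases "W d = 0") (simp_all add: power2_eq_square order_less_le)
  then show ?thesis unfolding W_def by blast
qed

end

theorem theorem6p1:
  fixes e :: "nat \<Rightarrow> 'a::{complex_inner, complete_space}"
    and \<Lambda> :: "'a \<Rightarrow> 'a \<Rightarrow> 'a"
    and \<alpha> :: "nat \<Rightarrow> complex"
  assumes "orthonormal_basis e"
    and "CAR \<Lambda>"
    and "summable (\<lambda>n. (cmod (\<alpha> n))\<^sup>2)"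
  shows "similar_to_contraction (Rop (Hankel_op \<alpha> (\<lambda>n. \<Lambda> (e n))))
     \<longleftrightarrow> quad_near_mod_H (Rop (Hankel_op \<alpha> (\<lambda>n. \<Lambda> (e n)))) R0"
proof -
  define C where "C n = \<Lambda> (e n)" for n
  define D where "D n = cadjoint (\<Lambda> (e n))" for n
  have bdd: "bounded_clinear_op (C n)" for n
    using assms(2) by (simp add: CAR_def C_def)
  have e: "cinner (e m) (e n) = (if m = n then 1 else 0)" for m n
    using assms(1) unfolding orthonormal_basis_def by blast
  interpret car_hilbert C D
  proof
    fix k l and x y :: 'a and a
    show "C k (x + y) = C k x + C k y" "C k (a *\<^sub>C x) = a *\<^sub>C C k x"
      using bdd[of k] by (simp_all add: bounded_clinear_op_def)
    show "cinner (C k x) y = cinner x (D k y)"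
      using cadjoint_cinner[OF assms(1) bdd[of k]] by (simp add: C_def D_def)
    show "C k (C l x) + C l (C k x) = 0"
      using assms(2) by (simp add: CAR_def C_def)
    show "C k (D l x) + D l (C k x) = (if k = l then x else 0)"
      using assms(2) by (simp add: CAR_def C_def D_def e scaleC_one)
  qed
  \<comment> \<open>A nonzero vector of the space, from which the vacuum vectors are built.\<close>
  have "e 0 \<noteq> 0" using e[of 0 0] by auto
  \<comment> \<open>Similarity and quadratic nearness are both compared with boundedness of the
    weighted matrix. From similarity, boundedness is reached through the square-summability of the
    weighted coefficients.\<close>
  have "similar_to_contraction (Rop (Hankel_op \<alpha> C)) \<longleftrightarrow>
      (\<exists>B\<ge>0. block_bounded (column_weighted \<alpha>) C B)"
  proof
    assume "similar_to_contraction (Rop (Hankel_op \<alpha> C))"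
    then obtain S where S: "\<And>d. (\<Sum>k<d. (real (Suc k) * cmod (\<alpha> k))\<^sup>2) \<le> S"
      using weighted_coefficients_bounded[OF assms(3) \<open>e 0 \<noteq> 0\<close>] by blast
    have "block_bounded (column_weighted \<alpha>) C (8 * S)"
      unfolding block_bounded_def column_weighted_def by (intro allI weighted_Hankel_bound S)
    moreover have "0 \<le> 8 * S" using S[of 0] by simp
    ultimately show "\<exists>B\<ge>0. block_bounded (column_weighted \<alpha>) C B" by blast
  next
    assume "\<exists>B\<ge>0. block_bounded (column_weighted \<alpha>) C B"
    then show "similar_to_contraction (Rop (Hankel_op \<alpha> C))"
      using similar_if_bounded by blast
  qed
  then show ?thesis
    using quad_near_iff[OF assms(3)] unfolding C_def[abs_def] by simp
qed

end
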